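(* Let $n$, the list $\{\lambda_1^*,\dots,\lambda_n^*\}$, the product manifold $\mathcal{Z}$ with its Riemannian metric and retraction $R$, the map $F:\mathcal{Z}\to\mathbb{R}^{n\times n}$, and the function $f(Z)=\frac12\|F(Z)\|_F^2$ be as defined in the context. Suppose the nonmonotone Riemannian inexact Newton-CG algorithm described in the context generates an infinite sequence $\{Z_k\}\subset\mathcal{Z}$. Then every accumulation point $Z_*\in\mathcal{Z}$ of $\{Z_k\}$ is a stationary point of $f$, i.e. $\mathrm{grad}\,f(Z_* )=0_{Z_*}$.
   Context: Spectral data. $\{\lambda_1^*,\dots,\lambda_n^*\}$ is a list of complex numbers closed under conjugation, ordered so that $\lambda_{2j-1}^*=a_j+b_j\mathrm{i}$, $\lambda_{2j}^*=a_j-b_j\mathrm{i}$ with $a_j,b_j\in\mathbb{R}$, $b_j\ne0$ for $j=1,\dots,s$, and $\lambda_j^*\in\mathbb{R}$ for $j=2s+1,\dots,n$. It is assumed realizable: there is at least one $n\times n$ positive doubly stochastic matrix with these eigenvalues. Let $\Lambda=\mathrm{diag}(a_1,a_1,\dots,a_s,a_s,\lambda_{2s+1}^*,\dots,\lambda_n^* )$. $\|\cdot\|_F$ and $\langle A,B\rangle_F=\mathrm{tr}(A^TB)$ are the Frobenius norm and inner product. Manifolds. Let $\mathcal{I}_1=\{(i,j): i\ge j\}$ and $\mathcal{I}_2=\{(2k-1,2k):k=1,\dots,s\}$, with $i,j\in\{1,\dots,n\}$, and let $\mathbf{e}$ be the all-ones $n$-vector. (1) $\mathbb{DP}_n$ is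 the set of entrywise positive $A\in\mathbb{R}^{n\times n}$ with $A\mathbf{e}=\mathbf{e}$, $A^T\mathbf{e}=\mathbf{e}$; tangent space $T_A\mathbb{DP}_n=\{\xi:\xi\mathbf{e}=0,\ \xi^T\mathbf{e}=0\}$; metric $\langle\xi,\eta\rangle=\sum_{i,j}\xi_{ij}\eta_{ij}/a_{ij}$; retraction $R_A(\xi)=\mathcal{P}(A\odot\exp(\xi\oslash A))$, where $\odot,\oslash$ are entrywise product and division, $\exp$ is entrywise, and $\mathcal{P}(B)$ is the doubly stochastic matrix $D_1BD_2$ ($D_1,D_2$ diagonal with positive diagonal) obtained from a positive matrix $B$ by the Sinkhorn-Knopp algorithm. (2) $\mathcal{O}(n)=\{Q\in\mathbb{R}^{n\times n}:Q^TQ=I_n\}$ with the metric $\mathrm{tr}(\xi^T\eta)$ and retraction $R_Q(\xi)=\mathrm{qf}(Q+\xi)$, the $Q$-factor of the QR decomposition whose $R$-factor has positive diagonal. (3) $\mathcal{W}=\{W\in\mathbb{R}^{n\times n}: w_{ij}=0\text{ for }(i,j)\notin\mathcal{I}_2,\ w_{ij}>0\text{ for }(i,j)\in\mathcal{I}_2\}$; tangent space $\{\xi:\xi_{ij}=0\text{ for }(i,j)\notin\mathcal{I}_2\}$; metric $\langle\xi,\eta\rangle=\sum_{(i,j)\in\mathcal{I}_2}\xi_{ij}\eta_{ij}/w_{ij}$; retraction $(R_W(\xi))_{ij}=w_{ij}\exp(\xi_{ij}/w_{ij})$ for $(i,j)\in\mathcal{I}_2$ and $0$ otherwise. (4) $\mathcal{V}=\{V\in\mathbb{R}^{n\times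 n}:v_{ij}=0\text{ for }(i,j)\in\mathcal{I}_1\cup\mathcal{I}_2\}$, a linear space with the Frobenius inner product and retraction $R_V(\xi)=V+\xi$. Let $\mathcal{Z}=\mathbb{DP}_n\times\mathcal{O}(n)\times\mathcal{W}\times\mathcal{V}$ with the product metric and the componentwise retraction $R$; $\|\cdot\|$ is the induced norm on tangent spaces. Equation. For $W\in\mathcal{W}$ let $\mathcal{A}(W)\in\mathbb{R}^{n\times n}$ have entries $(\mathcal{A}(W))_{ij}=-b_{i/2}^2/w_{ji}$ if $(j,i)\in\mathcal{I}_2$ and $0$ otherwise. Define $F:\mathcal{Z}\to\mathbb{R}^{n\times n}$ by $F(C,Q,W,V)=C-Q(\Lambda+\mathcal{A}(W)+W+V)Q^T$. For $Z\in\mathcal{Z}$, $\mathrm{D}F(Z):T_Z\mathcal{Z}\to\mathbb{R}^{n\times n}$ is the differential and $(\mathrm{D}F(Z))^*$ its adjoint with respect to the Riemannian metric on $T_Z\mathcal{Z}$ and the Frobenius inner product on $\mathbb{R}^{n\times n}$ (identified with $T_{F(Z)}\mathbb{R}^{n\times n}$). Let $f(Z)=\frac12\|F(Z)\|_F^2$; its Riemannian gradient is $\mathrm{grad}\,f(Z)=(\mathrm{D}F(Z))^*[F(Z)]$. Algorithm (nonmonotone Riemannian inexact Newton-CG method). Parameters: $\tau,\rho,\overline{\sigma}_{\max}\in(0,1)$, $\delta\in(0,\frac12)$, positive sequences $\{\eta_k\},\{\gamma_k\}$ with $\lim_{k\to\infty}\eta_k=0$ and $\sum_{k=0}^\infty\gamma_k=\gamma<\infty$,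 and a starting point $Z_0\in\mathcal{Z}$. For $k=0,1,2,\dots$ (stopping only if $F(Z_k)=0$): set $\overline{\sigma}_k=\min\{\overline{\sigma}_{\max},\|F(Z_k)\|_F\}$ and $\overline{\eta}_k=\min\{\eta_k,\|F(Z_k)\|_F\}$; using the conjugate gradient method compute $\Delta Y_k\in\mathbb{R}^{n\times n}$ with $$\|(\mathrm{D}F(Z_k)\circ(\mathrm{D}F(Z_k))^*+\overline{\sigma}_k\,\mathrm{id})[\Delta Y_k]+F(Z_k)\|_F\le\overline{\eta}_k\|F(Z_k)\|_F;$$ set $\Delta Z_k=(\mathrm{D}F(Z_k))^*[\Delta Y_k]$. If $\|F(R_{Z_k}(\Delta Z_k))\|_F\le\tau\|F(Z_k)\|_F$, set $\alpha_k=1$; otherwise let $\alpha_k$ be the largest element of $\{\rho^l:l=0,1,2,\dots\}$ such that $$\|F(R_{Z_k}(\alpha_k\Delta Z_k))\|_F^2-\|F(Z_k)\|_F^2\le-\delta\alpha_k^2|\langle\mathrm{grad}\,f(Z_k),\Delta Z_k\rangle|+\gamma_k\|F(Z_k)\|_F^2.$$ Set $Z_{k+1}=R_{Z_k}(\alpha_k\Delta Z_k)$. *)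

theory Defs
  imports "HOL-Analysis.Analysis"
begin

(* Matrices are real^'n^'n with n = CARD('n); rows and columns are numbered 1..n by pos,
   following the linear order of the finite index type.  On real^'n^'n the library's
   norm and inner product are the Frobenius norm and tr(A^T B). *)

type_synonym 'n matrix = "real^'n^'n"

(* a point (C, Q, W, V), or a tangent vector, of the product manifold *)
type_synonym 'n point = "'n matrix \<times> 'n matrix \<times> 'n matrix \<times> 'n matrix"

definition pos :: "'n::{finite,linorder} \<Rightarrow> nat" where
  "pos i = card {j. j \<le> i}"

definition I1 :: "('n::{finite,linorder} \<times> 'n) set" where
  "I1 = {(i, j). j \<le> i}"

definition I2 :: "nat \<Rightarrow> ('n::{finite,linorder} \<times> 'n) set" where
  "I2 s = {(i, j). \<exists>k\<in>{1..s}. pos i = 2 * k - 1 \<and> pos j = 2 * k}"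


(* lam is the list lam 1, ..., lam n; closure under conjugation follows from the ordering. *)
definition spectral_data ::
  "nat \<Rightarrow> nat \<Rightarrow> (nat \<Rightarrow> real) \<Rightarrow> (nat \<Rightarrow> real) \<Rightarrow> (nat \<Rightarrow> complex) \<Rightarrow> bool" where
  "spectral_data n s a b lam \<longleftrightarrow>
     2 * s \<le> n \<and>
     (\<forall>j\<in>{1..s}. lam (2 * j - 1) = Complex (a j) (b j) \<and>
                 lam (2 * j) = Complex (a j) (- b j) \<and> b j \<noteq> 0) \<and>
     (\<forall>j\<in>{2 * s + 1..n}. lam j \<in> \<real>)"

definition DP :: "'n::finite matrix set" where
  "DP = {A. (\<forall>i j. 0 < A $ i $ j) \<and> A *v 1 = 1 \<and> transpose A *v 1 = 1}"

(* The eigenvalues of A, counted with algebraic multiplicity, are lam 1, ..., lam n. *)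
definition has_eigenvalue_list :: "'n::finite matrix \<Rightarrow> (nat \<Rightarrow> complex) \<Rightarrow> bool" where
  "has_eigenvalue_list A lam \<longleftrightarrow>
     (\<forall>x. det (mat x - (\<chi> i j. complex_of_real (A $ i $ j)) :: complex^'n^'n) =
          (\<Prod>j = 1..CARD('n). x - lam j))"


definition Orth :: "'n::finite matrix set" where
  "Orth = {Q. orthogonal_matrix Q}"

definition Wset :: "nat \<Rightarrow> 'n::{finite,linorder} matrix set" where
  "Wset s = {W. \<forall>i j. if (i, j) \<in> I2 s then 0 < W $ i $ j else W $ i $ j = 0}"

definition Vset :: "nat \<Rightarrow> 'n::{finite,linorder} matrix set" where
  "Vset s = {V. \<forall>(i, j)\<in>I1 \<union> I2 s. V $ i $ j = 0}"

definition Zman :: "nat \<Rightarrow> 'n::{finite,linorder} point set" where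
  "Zman s = DP \<times> Orth \<times> Wset s \<times> Vset s"


definition tangent_DP :: "'n::finite matrix set" where
  "tangent_DP = {\<xi>. \<xi> *v 1 = 0 \<and> transpose \<xi> *v 1 = 0}"

definition tangent_Orth :: "'n::finite matrix \<Rightarrow> 'n matrix set" where
  "tangent_Orth Q = {\<xi>. transpose Q ** \<xi> + transpose \<xi> ** Q = 0}"

definition tangent_W :: "nat \<Rightarrow> 'n::{finite,linorder} matrix set" where
  "tangent_W s = {\<xi>. \<forall>i j. (i, j) \<notin> I2 s \<longrightarrow> \<xi> $ i $ j = 0}"

definition tangent :: "nat \<Rightarrow> 'n::{finite,linorder} point \<Rightarrow> 'n point set" where
  "tangent s = (\<lambda>(C, Q, W, V). tangent_DP \<times> tangent_Orth Q \<times> tangent_W s \<times> Vset s)"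


definition metric_DP :: "'n::finite matrix \<Rightarrow> 'n matrix \<Rightarrow> 'n matrix \<Rightarrow> real" where
  "metric_DP A \<xi> \<eta> = (\<Sum>i\<in>UNIV. \<Sum>j\<in>UNIV. \<xi> $ i $ j * \<eta> $ i $ j / A $ i $ j)"

definition metric_W ::
  "nat \<Rightarrow> 'n::{finite,linorder} matrix \<Rightarrow> 'n matrix \<Rightarrow> 'n matrix \<Rightarrow> real" where
  "metric_W s W \<xi> \<eta> = (\<Sum>(i, j)\<in>I2 s. \<xi> $ i $ j * \<eta> $ i $ j / W $ i $ j)"

definition metric ::
  "nat \<Rightarrow> 'n::{finite,linorder} point \<Rightarrow> 'n point \<Rightarrow> 'n point \<Rightarrow> real" where
  "metric s = (\<lambda>(C, Q, W, V) (\<xi>1, \<xi>2, \<xi>3, \<xi>4) (\<eta>1, \<eta>2, \<eta>3, \<eta>4).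
     metric_DP C \<xi>1 \<eta>1 + \<xi>2 \<bullet> \<eta>2 + metric_W s W \<xi>3 \<eta>3 + \<xi>4 \<bullet> \<eta>4)"


definition diag_mat :: "real^'n::finite \<Rightarrow> 'n matrix" where
  "diag_mat d = (\<chi> i j. if i = j then d $ i else 0)"

(* The limit of the Sinkhorn-Knopp iteration on a positive matrix B: by Sinkhorn's theorem
   it is the unique doubly stochastic matrix of the form D1 B D2. *)
definition sinkhorn :: "'n::finite matrix \<Rightarrow> 'n matrix" where
  "sinkhorn B = (THE P. P \<in> DP \<and>
     (\<exists>d1 d2. (\<forall>i. 0 < d1 $ i) \<and> (\<forall>i. 0 < d2 $ i) \<and> P = diag_mat d1 ** B ** diag_mat d2))"

definition retract_DP :: "'n::finite matrix \<Rightarrow> 'n matrix \<Rightarrow> 'n matrix" where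
  "retract_DP A \<xi> = sinkhorn (\<chi> i j. A $ i $ j * exp (\<xi> $ i $ j / A $ i $ j))"

definition qf :: "'n::{finite,linorder} matrix \<Rightarrow> 'n matrix" where
  "qf M = (THE Q. orthogonal_matrix Q \<and>
     (\<exists>U. (\<forall>i j. j < i \<longrightarrow> U $ i $ j = 0) \<and> (\<forall>i. 0 < U $ i $ i) \<and> M = Q ** U))"

definition retract_W ::
  "nat \<Rightarrow> 'n::{finite,linorder} matrix \<Rightarrow> 'n matrix \<Rightarrow> 'n matrix" where
  "retract_W s W \<xi> =
     (\<chi> i j. if (i, j) \<in> I2 s then W $ i $ j * exp (\<xi> $ i $ j / W $ i $ j) else 0)"

definition retract ::
  "nat \<Rightarrow> 'n::{finite,linorder} point \<Rightarrow> 'n point \<Rightarrow> 'n point" where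
  "retract s = (\<lambda>(C, Q, W, V) (\<xi>1, \<xi>2, \<xi>3, \<xi>4).
     (retract_DP C \<xi>1, qf (Q + \<xi>2), retract_W s W \<xi>3, V + \<xi>4))"


definition Lambda ::
  "nat \<Rightarrow> (nat \<Rightarrow> real) \<Rightarrow> (nat \<Rightarrow> complex) \<Rightarrow> 'n::{finite,linorder} matrix" where
  "Lambda s a lam =
     diag_mat (\<chi> i. if pos i \<le> 2 * s then a ((pos i + 1) div 2) else Re (lam (pos i)))"

definition Amap ::
  "nat \<Rightarrow> (nat \<Rightarrow> real) \<Rightarrow> 'n::{finite,linorder} matrix \<Rightarrow> 'n matrix" where
  "Amap s b W = (\<chi> i j. if (j, i) \<in> I2 s then - ((b (pos i div 2))\<^sup>2 / W $ j $ i) else 0)"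

definition Fmap ::
  "nat \<Rightarrow> (nat \<Rightarrow> real) \<Rightarrow> (nat \<Rightarrow> real) \<Rightarrow> (nat \<Rightarrow> complex) \<Rightarrow>
   'n::{finite,linorder} point \<Rightarrow> 'n matrix" where
  "Fmap s a b lam = (\<lambda>(C, Q, W, V).
     C - Q ** (Lambda s a lam + Amap s b W + W + V) ** transpose Q)"

definition objective ::
  "nat \<Rightarrow> (nat \<Rightarrow> real) \<Rightarrow> (nat \<Rightarrow> real) \<Rightarrow> (nat \<Rightarrow> complex) \<Rightarrow>
   'n::{finite,linorder} point \<Rightarrow> real" where
  "objective s a b lam Z = 1 / 2 * (norm (Fmap s a b lam Z))\<^sup>2"


(* The manifold is embedded in a Euclidean space and the formula for F is smooth in an ambient
   neighbourhood of each of its points, so the differential at Z of F (or of f) is the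
   restriction of the ambient Frechet derivative to the tangent space at Z.  Below it is only
   ever applied to tangent vectors. *)
definition DF ::
  "nat \<Rightarrow> (nat \<Rightarrow> real) \<Rightarrow> (nat \<Rightarrow> real) \<Rightarrow> (nat \<Rightarrow> complex) \<Rightarrow>
   'n::{finite,linorder} point \<Rightarrow> 'n point \<Rightarrow> 'n matrix" where
  "DF s a b lam Z = frechet_derivative (Fmap s a b lam) (at Z)"

definition DF_adjoint ::
  "nat \<Rightarrow> (nat \<Rightarrow> real) \<Rightarrow> (nat \<Rightarrow> real) \<Rightarrow> (nat \<Rightarrow> complex) \<Rightarrow>
   'n::{finite,linorder} point \<Rightarrow> 'n matrix \<Rightarrow> 'n point" where
  "DF_adjoint s a b lam Z Y = (THE \<zeta>. \<zeta> \<in> tangent s Z \<and>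
     (\<forall>\<xi>\<in>tangent s Z. metric s Z \<xi> \<zeta> = DF s a b lam Z \<xi> \<bullet> Y))"

definition riem_grad ::
  "nat \<Rightarrow> ('n::{finite,linorder} point \<Rightarrow> real) \<Rightarrow> 'n point \<Rightarrow> 'n point" where
  "riem_grad s h Z = (THE \<zeta>. \<zeta> \<in> tangent s Z \<and>
     (\<forall>\<xi>\<in>tangent s Z. metric s Z \<zeta> \<xi> = frechet_derivative h (at Z) \<xi>))"


(* One iteration with forcing terms etak, gammak.  Conjugate gradients are run, from an
   unspecified initial guess, until the residual test holds; so dY is any matrix that passes it. *)
definition newton_cg_step ::
  "nat \<Rightarrow> (nat \<Rightarrow> real) \<Rightarrow> (nat \<Rightarrow> real) \<Rightarrow> (nat \<Rightarrow> complex) \<Rightarrow>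
   real \<Rightarrow> real \<Rightarrow> real \<Rightarrow> real \<Rightarrow> real \<Rightarrow> real \<Rightarrow>
   'n::{finite,linorder} point \<Rightarrow> 'n point \<Rightarrow> bool" where
  "newton_cg_step s a b lam \<tau> \<rho> \<sigma>max \<delta> etak gammak Z Z' \<longleftrightarrow>
     (\<exists>dY dZ \<alpha>.
        let F = Fmap s a b lam;
            \<sigma> = min \<sigma>max (norm (F Z));
            \<eta> = min etak (norm (F Z));
            ls = (\<lambda>t. (norm (F (retract s Z (t *\<^sub>R dZ))))\<^sup>2 - (norm (F Z))\<^sup>2
                   \<le> - \<delta> * t\<^sup>2 * \<bar>metric s Z (riem_grad s (objective s a b lam) Z) dZ\<bar>
                      + gammak * (norm (F Z))\<^sup>2)
        in norm (DF s a b lam Z (DF_adjoint s a b lam Z dY) + \<sigma> *\<^sub>R dY + F Z) \<le> \<eta> * norm (F Z) \<and>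
           dZ = DF_adjoint s a b lam Z dY \<and>
           (if norm (F (retract s Z dZ)) \<le> \<tau> * norm (F Z) then \<alpha> = 1
            else \<alpha> \<in> {\<rho> ^ l | l. ls (\<rho> ^ l)} \<and> (\<forall>\<beta>\<in>{\<rho> ^ l | l. ls (\<rho> ^ l)}. \<beta> \<le> \<alpha>)) \<and>
           Z' = retract s Z (\<alpha> *\<^sub>R dZ))"

(* The algorithm stops only when F vanishes, so in an infinite run F (Z k) is never 0. *)
definition newton_cg_sequence ::
  "nat \<Rightarrow> (nat \<Rightarrow> real) \<Rightarrow> (nat \<Rightarrow> real) \<Rightarrow> (nat \<Rightarrow> complex) \<Rightarrow>
   real \<Rightarrow> real \<Rightarrow> real \<Rightarrow> real \<Rightarrow> (nat \<Rightarrow> real) \<Rightarrow> (nat \<Rightarrow> real) \<Rightarrow>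
   (nat \<Rightarrow> 'n::{finite,linorder} point) \<Rightarrow> bool" where
  "newton_cg_sequence s a b lam \<tau> \<rho> \<sigma>max \<delta> \<eta> \<gamma> Z \<longleftrightarrow>
     range Z \<subseteq> Zman s \<and>
     (\<forall>k. Fmap s a b lam (Z k) \<noteq> 0 \<and>
          newton_cg_step s a b lam \<tau> \<rho> \<sigma>max \<delta> (\<eta> k) (\<gamma> k) (Z k) (Z (Suc k)))"

end

(* Suppose F does not vanish at the limit. Along a subsequence sigma_k stays away from 0, hence dY_k and
   dZ_k are bounded and converge to Y and zeta. If zeta = 0, the Newton equation forces Y to be
   a multiple of F(Zstar), and passing to the limit in <xi, dZ_k> = <DF(Z_k) xi, dY_k> gives
   grad f = 0. If zeta is nonzero, the Newton equation makes it a strict descent direction; since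
   sum gamma_k converges, alpha_k^2 |<grad f, dZ_k>| tends to 0, so alpha_k tends to 0 and the line
   search rejects alpha_k / rho, which contradicts the first-order expansion of F along R.
   That expansion must be uniform in the base point: the Sinkhorn and QR corrections are therefore
   bounded quantitatively, to second order in the tangent vector. *)

theory Submission
  imports Defs
begin

section \<open>Sinkhorn scaling near a doubly stochastic matrix\<close>

text \<open>\<open>sinkhorn\<close> and \<open>qf\<close> are definite descriptions, so a retraction
  means something only where existence and uniqueness of the factorization are proved. The iterates
  lie in \<open>Zman s\<close> by definition of a run, and accepted steps are never expanded; only
  the rejected steps alpha_k / rho are, and these tend to 0. Hence the theory is local: Sinkhorn
  scaling of matrices whose row and column sums are nearly 1, Cholesky factors of matrices near the
  identity. For a tangent step both defects are of second order.

  An expansion of F at Zstar has an error measured against the distance to Zstar, not against t_k.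
  Derivatives are therefore taken as limits of (x'_k - x_k) / t_k with x_k converging, and the
  product and chain rules are redone in that form.

  Unit steps accepted by the tau test need their own argument: each counts (1 - tau^2) ||F||^2
  towards the summable decrease, so only finitely many occur on a subsequence along which F has a
  nonzero limit. With t^2 in the line search the demanded decrease is o(t), whereas a descent
  direction yields one of order t.\<close>

lemma norm_matrix_le_entries:
  fixes M :: "real^'n^'n"
  assumes "\<And>i j. \<bar>M $ i $ j\<bar> \<le> e"
  shows "norm M \<le> (real CARD('n))\<^sup>2 * e"
proof -
  have "norm M \<le> (\<Sum>i\<in>UNIV. norm (M $ i))"
    unfolding norm_vec_def by (rule L2_set_le_sum) simp
  also have "\<dots> \<le> (\<Sum>i\<in>(UNIV::'n set). \<Sum>j\<in>(UNIV::'n set). e)"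
    by (intro sum_mono order_trans[OF norm_le_l1_cart]) (simp add: assms)
  finally show ?thesis by (simp add: power2_eq_square)
qed

lemma entry_le_norm: "\<bar>M $ i $ j\<bar> \<le> norm (M :: real^'n^'m)"
  using component_le_norm_cart[of "M $ i" j] Finite_Cartesian_Product.norm_nth_le[of M i] by linarith

text \<open>The Lagrange remainder is \<open>exp t / 2 * u\<^sup>2\<close> with \<open>exp t\<close>
  between 1/2 and 2. The lower bound is the strong convexity behind the existence of the Sinkhorn
  scaling; the upper one controls the size of corrections.\<close>

lemma exp_quadratic_bounds:
  fixes u :: real
  assumes "\<bar>u\<bar> \<le> 1 / 2"
  shows "1 + u + u\<^sup>2 / 4 \<le> exp u" "exp u \<le> 1 + u + u\<^sup>2"
proof -
  obtain t where t: "\<bar>t\<bar> \<le> \<bar>u\<bar>" "exp u = (\<Sum>m<2. u ^ m / fact m) + exp t / fact 2 * u ^ 2"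
    using Maclaurin_exp_le[of u 2] by blast
  have e: "exp u = 1 + u + exp t / 2 * u\<^sup>2" using t(2) by (simp add: numeral_2_eq_2)
  have "exp t \<le> 2" using exp_bound_half[of t] t(1) assms by simp
  moreover have "exp t \<ge> 1 / 2" using exp_ge_add_one_self[of t] t(1) assms by linarith
  ultimately have "u\<^sup>2 * (1/2) \<le> u\<^sup>2 * exp t" "u\<^sup>2 * exp t \<le> u\<^sup>2 * 2"
    using mult_left_mono[of "1 / 2" "exp t" "u\<^sup>2"] mult_left_mono[of "exp t" 2 "u\<^sup>2"] by auto
  then show "1 + u + u\<^sup>2 / 4 \<le> exp u" "exp u \<le> 1 + u + u\<^sup>2" 
    by (auto simp: e algebra_simps)
qed

text \<open>Both \<open>retract_DP\<close> (before scaling) and \<open>retract_W\<close> have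
  entries c * exp (z / c). The error is at most z^2 / c, and \<open>h \<le> m / 2\<close> brings z /
  c into the range of \<open>exp_quadratic_bounds\<close>.\<close>

lemma exp_entry_estimate:
  fixes c z :: real
  assumes "0 < m" "m \<le> c" "\<bar>z\<bar> \<le> h" "h \<le> m / 2"
  shows "\<bar>c * exp (z / c) - c - z\<bar> \<le> h\<^sup>2 / m"
proof -
  have c: "0 < c" using assms by linarith
  have "\<bar>z / c\<bar> \<le> 1 / 2" using assms c by (simp add: field_simps)
  note b = exp_quadratic_bounds[OF this]
  have "c * exp (z / c) \<le> c * (1 + z / c + (z / c)\<^sup>2)" using b c by (intro mult_left_mono) auto
  also have "\<dots> = c + z + z\<^sup>2 / c" using c by (simp add: field_simps power2_eq_square)
  finally have u: "c * exp (z / c) - c - z \<le> z\<^sup>2 / c" by simp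
  have "1 + z / c \<le> exp (z / c)" by (rule exp_ge_add_one_self)
  then have "c * (1 + z / c) \<le> c * exp (z / c)" using c by (intro mult_left_mono) auto
  moreover have "c * (1 + z / c) = c + z" using c by (simp add: distrib_left)
  ultimately have l: "0 \<le> c * exp (z / c) - c - z" by linarith
  have "z\<^sup>2 \<le> h\<^sup>2" using assms(3) by (metis abs_ge_zero power2_abs power_mono)
  then have "z\<^sup>2 / c \<le> h\<^sup>2 / m" using assms by (intro frac_le) auto
  with u l show ?thesis by linarith
qed

lemma DP_iff:
  "A \<in> DP \<longleftrightarrow> (\<forall>i j. 0 < A $ i $ j) \<and> (\<forall>i. (\<Sum>j\<in>UNIV. A $ i $ j) = 1) \<and> (\<forall>j. (\<Sum>i\<in>UNIV. A $ i $ j) = 1)"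
  unfolding DP_def by (simp add: vec_eq_iff matrix_vector_mult_def transpose_def)

lemma tangent_DP_iff:
  "\<xi> \<in> tangent_DP \<longleftrightarrow> (\<forall>i. (\<Sum>j\<in>UNIV. \<xi> $ i $ j) = 0) \<and> (\<forall>j. (\<Sum>i\<in>UNIV. \<xi> $ i $ j) = 0)"
  unfolding tangent_DP_def by (simp add: vec_eq_iff matrix_vector_mult_def transpose_def)

lemma diag_scaling_entry:
  "(diag_mat d1 ** B ** diag_mat d2) $ i $ j = d1 $ i * B $ i $ j * d2 $ j"
  by (simp add: matrix_matrix_mult_def diag_mat_def if_distrib[of "\<lambda>x. x * _"] if_distrib[of "\<lambda>x. _ * x"]
      sum.delta sum.delta' cong: if_cong)

text \<open>
  For two doubly stochastic scalings \<open>P\<close>, \<open>P'\<close> with \<open>P' = P e^u\<close>, \<open>u = x \<oplus> y\<close>, the sum of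
  \<open>(P' - P) u\<close> vanishes although each term is nonnegative.
\<close>

lemma doubly_stochastic_scaling_unique:
  fixes P P' :: "real^'n^'n" and x y :: "real^'n"
  assumes P: "P \<in> DP" and P': "P' \<in> DP"
    and scal: "\<And>i j. P' $ i $ j = P $ i $ j * exp (x $ i + y $ j)"
  shows "P' = P"
proof -
  let ?t = "\<lambda>i j. (P' $ i $ j - P $ i $ j) * (x $ i + y $ j)"
  have "(\<Sum>i\<in>UNIV. \<Sum>j\<in>UNIV. ?t i j) =
      (\<Sum>i\<in>UNIV. x $ i * (\<Sum>j\<in>UNIV. P' $ i $ j - P $ i $ j))
      + (\<Sum>i\<in>UNIV. \<Sum>j\<in>UNIV. y $ j * (P' $ i $ j - P $ i $ j))"
    by (simp add: algebra_simps sum.distrib sum_distrib_left sum_subtractf)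
  also have "(\<Sum>i\<in>UNIV. \<Sum>j\<in>UNIV. y $ j * (P' $ i $ j - P $ i $ j))
      = (\<Sum>j\<in>UNIV. y $ j * (\<Sum>i\<in>UNIV. P' $ i $ j - P $ i $ j))"
    by (subst sum.swap) (simp add: sum_distrib_left)
  finally have 0: "(\<Sum>i\<in>UNIV. \<Sum>j\<in>UNIV. ?t i j) = 0"
    using P P' by (simp add: DP_iff sum_subtractf)
  have nn: "?t i j \<ge> 0" for i j
  proof -
    have "?t i j = P $ i $ j * ((exp (x $ i + y $ j) - 1) * (x $ i + y $ j))"
      by (simp add: scal algebra_simps)
    moreover have "(exp u - 1) * u \<ge> 0" for u :: real
      by (cases "u \<ge> 0") (auto intro: mult_nonpos_nonpos)
    moreover have "P $ i $ j \<ge> 0" using P by (simp add: DP_iff less_imp_le)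
    ultimately show ?thesis by (metis mult_nonneg_nonneg)
  qed
  have "?t i j = 0" for i j
    using 0 nn by (simp add: sum_nonneg_eq_0_iff sum_nonneg)
  then have "P' $ i $ j = P $ i $ j" for i j
    by (metis (no_types, lifting) add.right_neutral diff_add_cancel exp_zero mult.right_neutral mult_eq_0_iff scal add_0)
  then show ?thesis by (simp add: vec_eq_iff)
qed

text \<open>With positive diagonals written as exponentials, a competitor \<open>P'\<close> is
  \<open>P\<close> scaled by the exponents ln d1 - x and ln d2 - y, so
  \<open>doubly_stochastic_scaling_unique\<close> forces equality.\<close>

lemma sinkhorn_eqI:
  fixes B P :: "real^'n^'n" and x y :: "real^'n"
  assumes P: "P \<in> DP" and scal: "\<And>i j. P $ i $ j = B $ i $ j * exp (x $ i + y $ j)"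
  shows "sinkhorn B = P"
  unfolding sinkhorn_def
proof (rule the_equality)
  let ?X = "\<chi> i. exp (x $ i)" and ?Y = "\<chi> i. exp (y $ i)"
  have "P = diag_mat ?X ** B ** diag_mat ?Y"
    by (simp add: vec_eq_iff diag_scaling_entry scal exp_add)
  then show "P \<in> DP \<and> (\<exists>d1 d2. (\<forall>i. 0 < d1 $ i) \<and> (\<forall>i. 0 < d2 $ i) \<and> P = diag_mat d1 ** B ** diag_mat d2)"
    using P by (intro conjI exI[of _ ?X] exI[of _ ?Y]) auto
next
  fix P'
  assume "P' \<in> DP \<and> (\<exists>d1 d2. (\<forall>i. 0 < d1 $ i) \<and> (\<forall>i. 0 < d2 $ i) \<and> P' = diag_mat d1 ** B ** diag_mat d2)"
  then obtain d1 d2 where P': "P' \<in> DP" and d: "\<forall>i. 0 < d1 $ i" "\<forall>i. 0 < d2 $ i"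
    and eq: "P' = diag_mat d1 ** B ** diag_mat d2" by blast
  have "P' $ i $ j = P $ i $ j * exp ((\<chi> i. ln (d1 $ i) - x $ i) $ i + (\<chi> j. ln (d2 $ j) - y $ j) $ j)" for i j
    using d unfolding eq diag_scaling_entry scal by (simp add: exp_add exp_diff)
  then show "P' = P" by (rule doubly_stochastic_scaling_unique[OF P P'])
qed

text \<open>
  The Sinkhorn scaling factors \<open>e^x\<close>, \<open>e^y\<close> are the critical points of the convex function
  \<open>\<Sum> B_ij e^(x_i + y_j) - \<Sum> x_i - \<Sum> y_j\<close>.  The penalty term removes its invariance along
  \<open>(1, -1)\<close> without changing the value of the critical scaling.
\<close>

definition scaling_potential :: "real \<Rightarrow> real^'n^'n \<Rightarrow> (real^'n) \<times> (real^'n) \<Rightarrow> real" where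
  "scaling_potential m B z = (\<Sum>i\<in>UNIV. \<Sum>j\<in>UNIV. B $ i $ j * exp (fst z $ i + snd z $ j))
     - (\<Sum>i\<in>UNIV. fst z $ i) - (\<Sum>j\<in>UNIV. snd z $ j)
     + m / 8 * ((\<Sum>i\<in>UNIV. fst z $ i) - (\<Sum>j\<in>UNIV. snd z $ j))\<^sup>2"

lemma has_derivative_scaling_potential:
  fixes B :: "real^'n^'n"
  shows "(scaling_potential m B has_derivative (\<lambda>v.
     (\<Sum>i\<in>UNIV. \<Sum>j\<in>UNIV. B $ i $ j * exp (fst z $ i + snd z $ j) * (fst v $ i + snd v $ j))
     - (\<Sum>i\<in>UNIV. fst v $ i) - (\<Sum>j\<in>UNIV. snd v $ j)
     + m / 4 * ((\<Sum>i\<in>UNIV. fst z $ i) - (\<Sum>j\<in>UNIV. snd z $ j))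
         * ((\<Sum>i\<in>UNIV. fst v $ i) - (\<Sum>j\<in>UNIV. snd v $ j)))) (at z)"
  unfolding scaling_potential_def
  by (rule derivative_eq_intros has_derivative_sum bounded_linear.has_derivative[OF bounded_linear_vec_nth] refl)+
     (simp add: algebra_simps add_divide_distrib diff_divide_distrib)

text \<open>The quadratic growth comes from the second-order parts of the exponentials, each
  weighted by at least \<open>m\<close>. Because \<open>B\<close> is nearly doubly stochastic, the
  linear parts almost cancel against the subtracted sums. \<open>norm z \<le> 1 / 4\<close> keeps
  every exponent within 1/2.\<close>

lemma scaling_potential_lower_bound:
  fixes B :: "real^'n^'n"
  assumes m: "0 < m" "\<And>i j. m \<le> B $ i $ j"
    and rows: "\<And>i. \<bar>(\<Sum>j\<in>UNIV. B $ i $ j) - 1\<bar> \<le> \<epsilon>"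
    and cols: "\<And>j. \<bar>(\<Sum>i\<in>UNIV. B $ i $ j) - 1\<bar> \<le> \<epsilon>"
    and z: "norm z \<le> 1 / 4"
  shows "scaling_potential m B z - scaling_potential m B 0
    \<ge> real CARD('n) * (m / 4 * (norm z)\<^sup>2 - 2 * \<epsilon> * norm z)"
proof -
  obtain x y where zxy: "z = (x, y)" by fastforce
  have comp: "\<bar>x $ i\<bar> \<le> norm z" "\<bar>y $ i\<bar> \<le> norm z" for i
    using component_le_norm_cart[of x i] component_le_norm_cart[of y i] norm_fst_le[of x y] norm_snd_le[of y x]
    unfolding zxy by linarith+
  have e: "\<epsilon> \<ge> 0" using rows[of undefined] by linarith
  let ?X = "\<Sum>i\<in>UNIV. x $ i" and ?Y = "\<Sum>i\<in>UNIV. y $ i" and ?n = "real CARD('n)"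
  have pw: "B $ i $ j * exp (x $ i + y $ j) - B $ i $ j \<ge> B $ i $ j * x $ i + B $ i $ j * y $ j + m / 4 * (x $ i + y $ j)\<^sup>2" for i j
  proof -
    have "\<bar>x $ i + y $ j\<bar> \<le> 1 / 2" using comp(1)[of i] comp(2)[of j] z by linarith
    then have "1 + (x $ i + y $ j) + (x $ i + y $ j)\<^sup>2 / 4 \<le> exp (x $ i + y $ j)"
      by (rule exp_quadratic_bounds)
    then have "B $ i $ j * (1 + (x $ i + y $ j) + (x $ i + y $ j)\<^sup>2 / 4) \<le> B $ i $ j * exp (x $ i + y $ j)"
      using m(1) m(2)[of i j] by (intro mult_left_mono) auto
    moreover have "m * ((x $ i + y $ j)\<^sup>2 / 4) \<le> B $ i $ j * ((x $ i + y $ j)\<^sup>2 / 4)"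
      using m(2) by (intro mult_right_mono) auto
    ultimately show ?thesis by (simp add: algebra_simps)
  qed
  have nz: "(norm z)\<^sup>2 = (\<Sum>i\<in>UNIV. (x $ i)\<^sup>2) + (\<Sum>i\<in>UNIV. (y $ i)\<^sup>2)"
    unfolding zxy norm_Pair by (simp add: norm_vec_def L2_set_def sum_nonneg)
  have sq: "(\<Sum>i\<in>UNIV. \<Sum>j\<in>UNIV. (x $ i + y $ j)\<^sup>2) = ?n * (norm z)\<^sup>2 + 2 * ?X * ?Y"
  proof -
    have "(\<Sum>i\<in>UNIV. \<Sum>j\<in>UNIV. (x $ i + y $ j)\<^sup>2)
        = (\<Sum>i\<in>UNIV. \<Sum>j\<in>UNIV. (x $ i)\<^sup>2 + (y $ j)\<^sup>2 + 2 * (x $ i * y $ j))"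
      by (simp add: power2_sum mult.assoc)
    also have "\<dots> = ?n * (norm z)\<^sup>2 + 2 * (\<Sum>i\<in>UNIV. \<Sum>j\<in>UNIV. x $ i * y $ j)"
      unfolding nz by (simp add: sum.distrib sum_distrib_left[symmetric] distrib_left)
    finally show ?thesis by (simp add: sum_product)
  qed
  have "(\<Sum>i\<in>UNIV. \<Sum>j\<in>UNIV. B $ i $ j * exp (x $ i + y $ j) - B $ i $ j) \<ge>
     (\<Sum>i\<in>UNIV. \<Sum>j\<in>UNIV. B $ i $ j * x $ i + B $ i $ j * y $ j + m / 4 * (x $ i + y $ j)\<^sup>2)"
    by (intro sum_mono pw)
  also have "(\<Sum>i\<in>UNIV. \<Sum>j\<in>UNIV. B $ i $ j * x $ i + B $ i $ j * y $ j + m / 4 * (x $ i + y $ j)\<^sup>2)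
     = (\<Sum>i\<in>UNIV. \<Sum>j\<in>UNIV. B $ i $ j * x $ i) + (\<Sum>i\<in>UNIV. \<Sum>j\<in>UNIV. B $ i $ j * y $ j)
       + m / 4 * (?n * (norm z)\<^sup>2 + 2 * ?X * ?Y)"
    unfolding sq[symmetric] by (simp only: sum.distrib sum_distrib_left)
  also have "(\<Sum>i\<in>UNIV. \<Sum>j\<in>UNIV. B $ i $ j * y $ j) = (\<Sum>j\<in>UNIV. \<Sum>i\<in>UNIV. B $ i $ j * y $ j)"
    by (rule sum.swap)
  finally have main: "(\<Sum>i\<in>UNIV. \<Sum>j\<in>UNIV. B $ i $ j * exp (x $ i + y $ j) - B $ i $ j) \<ge>
      (\<Sum>i\<in>UNIV. (\<Sum>j\<in>UNIV. B $ i $ j) * x $ i) + (\<Sum>j\<in>UNIV. (\<Sum>i\<in>UNIV. B $ i $ j) * y $ j)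
       + m / 4 * (?n * (norm z)\<^sup>2 + 2 * ?X * ?Y)"
    by (simp add: sum_distrib_right)
  have "\<bar>\<Sum>i\<in>UNIV. (\<Sum>j\<in>UNIV. B $ i $ j) * x $ i - x $ i\<bar> \<le> (\<Sum>i\<in>(UNIV::'n set). \<epsilon> * norm z)"
  proof (intro order_trans[OF sum_abs] sum_mono)
    fix i
    have "\<bar>(\<Sum>j\<in>UNIV. B $ i $ j) - 1\<bar> * \<bar>x $ i\<bar> \<le> \<epsilon> * norm z"
      using rows comp e by (intro mult_mono) auto
    then show "\<bar>(\<Sum>j\<in>UNIV. B $ i $ j) * x $ i - x $ i\<bar> \<le> \<epsilon> * norm z"
      by (simp add: abs_mult[symmetric] algebra_simps)
  qed
  moreover have "\<bar>\<Sum>j\<in>UNIV. (\<Sum>i\<in>UNIV. B $ i $ j) * y $ j - y $ j\<bar> \<le> (\<Sum>i\<in>(UNIV::'n set). \<epsilon> * norm z)"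
  proof (intro order_trans[OF sum_abs] sum_mono)
    fix j
    have "\<bar>(\<Sum>i\<in>UNIV. B $ i $ j) - 1\<bar> * \<bar>y $ j\<bar> \<le> \<epsilon> * norm z"
      using cols comp e by (intro mult_mono) auto
    then show "\<bar>(\<Sum>i\<in>UNIV. B $ i $ j) * y $ j - y $ j\<bar> \<le> \<epsilon> * norm z"
      by (simp add: abs_mult[symmetric] algebra_simps)
  qed
  ultimately have lin: "(\<Sum>i\<in>UNIV. (\<Sum>j\<in>UNIV. B $ i $ j) * x $ i) - ?X + ((\<Sum>j\<in>UNIV. (\<Sum>i\<in>UNIV. B $ i $ j) * y $ j) - ?Y)
      \<ge> - 2 * (?n * \<epsilon> * norm z)"
    by (simp add: sum_subtractf)
  \<comment> \<open>Expanding the squares leaves a cross term m/2 X Y of unknown sign. The penalty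
    weight m/8 is the one that completes it to m/8 (X + Y)^2.\<close>
  have "0 \<le> m / 8 * (?X + ?Y)\<^sup>2" using m by simp
  then have pen: "m / 4 * (2 * ?X * ?Y) + m / 8 * (?X - ?Y)\<^sup>2 \<ge> 0"
    by (simp add: power2_eq_square algebra_simps)
  have "scaling_potential m B z - scaling_potential m B 0 =
     (\<Sum>i\<in>UNIV. \<Sum>j\<in>UNIV. B $ i $ j * exp (x $ i + y $ j) - B $ i $ j) - ?X - ?Y + m / 8 * (?X - ?Y)\<^sup>2"
    unfolding scaling_potential_def zxy by (simp add: sum_subtractf)
  with main lin pen show ?thesis by (simp add: algebra_simps)
qed

text \<open>A minimiser of the potential on a closed ball exists by compactness. The lower bound on
  \<open>r\<close> keeps it off the boundary, so it is a critical point, and the radius bounds its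
  exponents.\<close>

lemma sinkhorn_near:
  fixes B :: "real^'n^'n"
  assumes m: "0 < m" "\<And>i j. m \<le> B $ i $ j"
    and rows: "\<And>i. \<bar>(\<Sum>j\<in>UNIV. B $ i $ j) - 1\<bar> \<le> \<epsilon>"
    and cols: "\<And>j. \<bar>(\<Sum>i\<in>UNIV. B $ i $ j) - 1\<bar> \<le> \<epsilon>"
    and r: "8 * \<epsilon> / m < r" "r \<le> 1 / 4"
  shows "\<exists>x y. (\<forall>i j. \<bar>x $ i + y $ j\<bar> \<le> 2 * r) \<and>
     sinkhorn B = (\<chi> i j. B $ i $ j * exp (x $ i + y $ j))"
proof -
  have e: "\<epsilon> \<ge> 0" using rows[of undefined] by linarith
  have "0 \<le> 8 * \<epsilon> / m" using e m by simp
  then have r0: "0 < r" using r by linarith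
  let ?g = "scaling_potential m B"
  let ?S = "cball (0 :: (real^'n) \<times> (real^'n)) r"
  have "continuous_on ?S ?g"
    by (intro continuous_at_imp_continuous_on ballI has_derivative_continuous[OF has_derivative_scaling_potential])
  then obtain z where z: "z \<in> ?S" and min: "\<forall>w\<in>?S. ?g z \<le> ?g w"
    using continuous_attains_inf[of ?S ?g] r0 by (auto simp: cball_eq_empty)
  \<comment> \<open>On the sphere the potential exceeds its value at 0 by at least n r (m/4) (r - 8
    \<epsilon> / m), which is positive beyond the threshold assumed for \<open>r\<close>.\<close>
  have "norm z \<noteq> r"
  proof
    assume zr: "norm z = r"
    have "?g z - ?g 0 \<ge> real CARD('n) * (m / 4 * r\<^sup>2 - 2 * \<epsilon> * r)"
      using scaling_potential_lower_bound[OF m rows cols, of z] r zr by simp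
    also have "m / 4 * r\<^sup>2 - 2 * \<epsilon> * r = r * (m / 4) * (r - 8 * \<epsilon> / m)"
      using m by (simp add: field_simps power2_eq_square)
    finally have "?g z - ?g 0 \<ge> real CARD('n) * (r * (m / 4) * (r - 8 * \<epsilon> / m))" .
    moreover have "0 < real CARD('n) * (r * (m / 4) * (r - 8 * \<epsilon> / m))"
      using r0 r m by (intro mult_pos_pos) auto
    ultimately have "?g z - ?g 0 > 0" by linarith
    moreover have "?g z \<le> ?g 0" using min r0 by simp
    ultimately show False by simp
  qed
  then have zb: "z \<in> ball 0 r" using z by simp
  define D where "D = (\<lambda>v.
     (\<Sum>i\<in>UNIV. \<Sum>j\<in>UNIV. B $ i $ j * exp (fst z $ i + snd z $ j) * (fst v $ i + snd v $ j))
     - (\<Sum>i\<in>UNIV. fst v $ i) - (\<Sum>j\<in>UNIV. snd v $ j)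
     + m / 4 * ((\<Sum>i\<in>UNIV. fst z $ i) - (\<Sum>j\<in>UNIV. snd z $ j))
         * ((\<Sum>i\<in>UNIV. fst v $ i) - (\<Sum>j\<in>UNIV. snd v $ j)))"
  have "D = (\<lambda>v. 0)"
  proof (rule differential_zero_maxmin[OF zb open_ball])
    show "(?g has_derivative D) (at z)" unfolding D_def by (rule has_derivative_scaling_potential)
    show "(\<forall>w\<in>ball 0 r. ?g w \<le> ?g z) \<or> (\<forall>w\<in>ball 0 r. ?g z \<le> ?g w)" using min by auto
  qed
  then have D0: "D v = 0" for v by simp
  define P where "P = (\<chi> i j. B $ i $ j * exp (fst z $ i + snd z $ j))"
  let ?u = "(\<Sum>i\<in>UNIV. fst z $ i) - (\<Sum>j\<in>UNIV. snd z $ j)"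
  have "(\<Sum>i\<in>UNIV. \<Sum>j\<in>UNIV. P $ i $ j * snd v $ j) = (\<Sum>j\<in>UNIV. \<Sum>i\<in>UNIV. P $ i $ j * snd v $ j)"
    for v :: "(real^'n) \<times> (real^'n)" by (rule sum.swap)
  then have D_eq: "D v = (\<Sum>i\<in>UNIV. (\<Sum>j\<in>UNIV. P $ i $ j) * fst v $ i) + (\<Sum>j\<in>UNIV. (\<Sum>i\<in>UNIV. P $ i $ j) * snd v $ j)
      - (\<Sum>i\<in>UNIV. fst v $ i) - (\<Sum>j\<in>UNIV. snd v $ j)
      + m / 4 * ?u * ((\<Sum>i\<in>UNIV. fst v $ i) - (\<Sum>j\<in>UNIV. snd v $ j))" for v
    unfolding D_def P_def vec_lambda_beta by (simp only: distrib_left sum.distrib sum_distrib_right)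
  have sum_axis: "(\<Sum>i\<in>UNIV. f i * axis k 1 $ i) = f k" "(\<Sum>i\<in>UNIV. axis k 1 $ i) = 1"
    for k :: 'n and f :: "'n \<Rightarrow> real"
    by (simp_all add: axis_def if_distrib[of "\<lambda>x. _ * x"] cong: if_cong)
  \<comment> \<open>In the direction (1, -1) the two totals of \<open>P\<close> cancel and only the
    derivative of the penalty remains, so it is 0. The coordinate directions then yield row and
    column sums 1.\<close>
  have "(\<Sum>i\<in>UNIV. \<Sum>j\<in>UNIV. P $ i $ j) = (\<Sum>j\<in>UNIV. \<Sum>i\<in>UNIV. P $ i $ j)" by (rule sum.swap)
  then have "D (1, - 1) = m / 4 * ?u * (2 * real CARD('n))" unfolding D_eq by (simp add: sum_negf)
  then have pen: "?u = 0" using m D0[of "(1, - 1)"] by simp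
  have "(\<Sum>j\<in>UNIV. P $ k $ j) = 1" for k
    using D0[of "(axis k 1, 0)"] unfolding D_eq pen by (simp add: sum_axis)
  moreover have "(\<Sum>i\<in>UNIV. P $ i $ k) = 1" for k
    using D0[of "(0, axis k 1)"] unfolding D_eq pen by (simp add: sum_axis)
  moreover have "P $ i $ j > 0" for i j using m(1) m(2)[of i j] unfolding P_def by simp
  ultimately have "P \<in> DP" by (simp add: DP_iff)
  then have "sinkhorn B = P"
    by (rule sinkhorn_eqI[where x = "fst z" and y = "snd z"]) (simp add: P_def)
  moreover have "\<bar>fst z $ i + snd z $ j\<bar> \<le> 2 * r" for i j
    using component_le_norm_cart[of "fst z" i] component_le_norm_cart[of "snd z" j]
      norm_fst_le[of "fst z" "snd z"] norm_snd_le[of "snd z" "fst z"] zb by auto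
  ultimately show ?thesis unfolding P_def by blast
qed

text \<open>A tangent vector has zero row and column sums, so those of \<open>B\<close> miss 1 only
  by the exponential remainder, which is O(h^2). \<open>sinkhorn_near\<close> turns this defect into
  scaling exponents of the same order. The constants depend on \<open>C\<close> only through its
  lower bound \<open>m\<close>.\<close>

lemma retract_DP_estimate:
  fixes C :: "real^'n^'n"
  assumes m: "0 < m" "m \<le> 1" "\<And>i j. m \<le> C $ i $ j" and C: "C \<in> DP" and \<zeta>: "\<zeta> \<in> tangent_DP"
    and h: "0 < h" "norm \<zeta> \<le> h" "h \<le> m\<^sup>2 / (80 * real CARD('n))"
  shows "norm (retract_DP C \<zeta> - C - \<zeta>) \<le> 500 * (real CARD('n))^3 / m\<^sup>2 * h\<^sup>2"
proof -
  let ?n = "real CARD('n)"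
  have n: "?n \<ge> 1" by (simp add: Suc_leI)
  have hm: "h \<le> m / 2" 
  proof -
    have "m\<^sup>2 / (80 * ?n) \<le> m / 2"
      using m n mult_mono[of m 1 1 ?n] by (auto simp: divide_simps power2_eq_square)
    then show ?thesis using h by linarith
  qed
  define B where "B = (\<chi> i j. C $ i $ j * exp (\<zeta> $ i $ j / C $ i $ j))"
  have Best: "\<bar>B $ i $ j - C $ i $ j - \<zeta> $ i $ j\<bar> \<le> h\<^sup>2 / m" for i j
    unfolding B_def vec_lambda_beta
    using exp_entry_estimate[OF m(1,3) order_trans[OF entry_le_norm h(2)] hm] .
  have hsq: "h\<^sup>2 / m \<le> m / 4"
  proof -
    have "h\<^sup>2 \<le> (m / 2)\<^sup>2" using hm h by (intro power_mono) auto
    then show ?thesis using m by (simp add: field_simps power2_eq_square)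
  qed
  have zh: "\<bar>\<zeta> $ i $ j\<bar> \<le> m / 2" for i j using entry_le_norm[of \<zeta> i j] h hm by linarith
  have Bm: "m / 4 \<le> B $ i $ j" for i j using Best[of i j] zh[of i j] m(3)[of i j] hsq by linarith
  have C1: "C $ i $ j \<le> 1" for i j
  proof -
    have "C $ i $ j \<le> (\<Sum>j\<in>UNIV. C $ i $ j)" using C by (intro member_le_sum) (auto simp: DP_iff less_imp_le)
    then show ?thesis using C by (simp add: DP_iff)
  qed
  have B2: "B $ i $ j \<le> 2" for i j using Best[of i j] zh[of i j] C1[of i j] hsq m(2) by linarith
  define \<epsilon> where "\<epsilon> = ?n * (h\<^sup>2 / m)"
  have rows: "\<bar>(\<Sum>j\<in>UNIV. B $ i $ j) - 1\<bar> \<le> \<epsilon>" for i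
  proof -
    have "(\<Sum>j\<in>UNIV. B $ i $ j) - 1 = (\<Sum>j\<in>UNIV. B $ i $ j - C $ i $ j - \<zeta> $ i $ j)"
      using C \<zeta> by (simp add: DP_iff tangent_DP_iff sum_subtractf)
    also have "\<bar>\<dots>\<bar> \<le> (\<Sum>j\<in>(UNIV::'n set). h\<^sup>2 / m)"
      by (intro order_trans[OF sum_abs] sum_mono Best)
    finally show ?thesis by (simp add: \<epsilon>_def)
  qed
  have cols: "\<bar>(\<Sum>i\<in>UNIV. B $ i $ j) - 1\<bar> \<le> \<epsilon>" for j
  proof -
    have "(\<Sum>i\<in>UNIV. B $ i $ j) - 1 = (\<Sum>i\<in>UNIV. B $ i $ j - C $ i $ j - \<zeta> $ i $ j)"
      using C \<zeta> by (simp add: DP_iff tangent_DP_iff sum_subtractf)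
    also have "\<bar>\<dots>\<bar> \<le> (\<Sum>j\<in>(UNIV::'n set). h\<^sup>2 / m)"
      by (intro order_trans[OF sum_abs] sum_mono Best)
    finally show ?thesis by (simp add: \<epsilon>_def)
  qed
  \<comment> \<open>Entries of \<open>B\<close> are at least m/4, so the threshold is 8 \<epsilon> /
    (m/4) = 32 n h^2 / m^2, and 40 leaves a strict margin. The bound m^2 / (80 n) on
    \<open>h\<close>, with h at most 1/2, is what gives \<open>r \<le> 1 / 4\<close>.\<close>
  define r where "r = 40 * ?n * h\<^sup>2 / m\<^sup>2"
  have r1: "8 * \<epsilon> / (m / 4) < r" 
    unfolding r_def \<epsilon>_def using m n h by (simp add: field_simps power2_eq_square)
  have r2: "r \<le> 1 / 4"
  proof -
    have hn: "h * (80 * ?n) \<le> m\<^sup>2" using h(3) n by (simp add: field_simps)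
    have "m\<^sup>2 > 0" using m by simp
    have "h \<le> 1 / 2" using hm m by linarith
    then have "h * (h * (80 * ?n)) \<le> 1 / 2 * m\<^sup>2" using h n hn by (intro mult_mono) auto
    then show "r \<le> 1 / 4" unfolding r_def using \<open>m\<^sup>2 > 0\<close>
      by (simp add: field_simps power2_eq_square)
  qed
  obtain x y where u: "\<And>i j. \<bar>x $ i + y $ j\<bar> \<le> 2 * r"
    and S: "sinkhorn B = (\<chi> i j. B $ i $ j * exp (x $ i + y $ j))"
    using sinkhorn_near[OF _ Bm rows cols r1 r2] m by auto
  have "\<bar>(retract_DP C \<zeta> - C - \<zeta>) $ i $ j\<bar> \<le> 12 * r + h\<^sup>2 / m" for i j
  proof -
    let ?u = "x $ i + y $ j"
    have uh: "\<bar>?u\<bar> \<le> 1 / 2" using u[of i j] r2 by linarith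
    have "\<bar>?u\<bar> * \<bar>?u\<bar> \<le> 1 * \<bar>?u\<bar>" using uh by (intro mult_right_mono) auto
    then have "?u\<^sup>2 \<le> \<bar>?u\<bar>" by (simp add: power2_eq_square)
    then have "\<bar>exp ?u - 1\<bar> \<le> 2 * \<bar>?u\<bar>"
      using exp_quadratic_bounds[OF uh] by (smt (verit) zero_le_power2 divide_nonneg_nonneg)
    also have "\<dots> \<le> 4 * r" using u[of i j] by simp
    finally have "\<bar>exp ?u - 1\<bar> \<le> 4 * r" .
    then have "\<bar>B $ i $ j\<bar> * \<bar>exp ?u - 1\<bar> \<le> 2 * (4 * r)"
      using B2[of i j] Bm[of i j] m by (intro mult_mono) auto
    then have "\<bar>B $ i $ j * exp ?u - B $ i $ j\<bar> \<le> 8 * r"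
      by (simp add: abs_mult[symmetric] algebra_simps)
    moreover have "(retract_DP C \<zeta> - C - \<zeta>) $ i $ j = B $ i $ j * exp ?u - C $ i $ j - \<zeta> $ i $ j"
      unfolding retract_DP_def B_def[symmetric] S by simp
    moreover have "r \<ge> 0" using u[of i j] by linarith
    ultimately show ?thesis using Best[of i j] by linarith
  qed
  then have "norm (retract_DP C \<zeta> - C - \<zeta>) \<le> ?n\<^sup>2 * (12 * r + h\<^sup>2 / m)"
    by (rule norm_matrix_le_entries)
  \<comment> \<open>The term 12 r accounts for 480 of the 500, and h^2 / m adds at most n h^2 /
    m^2.\<close>
  also have "\<dots> \<le> ?n\<^sup>2 * (500 * ?n / m\<^sup>2 * h\<^sup>2)"
  proof (intro mult_left_mono)
    have "h\<^sup>2 / m \<le> ?n * h\<^sup>2 / m\<^sup>2"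
    proof -
      have "m * 1 \<le> 1 * ?n" using m n by (intro mult_mono) auto
      then have "h\<^sup>2 * m \<le> h\<^sup>2 * ?n" by (intro mult_left_mono) auto
      then show ?thesis using m by (simp add: field_simps power2_eq_square)
    qed
    moreover have "12 * r + ?n * h\<^sup>2 / m\<^sup>2 \<le> 500 * ?n / m\<^sup>2 * h\<^sup>2"
      unfolding r_def using m n by (simp add: field_simps)
    ultimately show "12 * r + h\<^sup>2 / m \<le> 500 * ?n / m\<^sup>2 * h\<^sup>2" by linarith
  qed auto
  finally show ?thesis by (simp add: power2_eq_square power3_eq_cube algebra_simps)
qed

section \<open>QR factorization near an orthogonal matrix\<close>

lemma norm_matrix_power2: "(norm (M :: real^'n^'m))\<^sup>2 = (\<Sum>i\<in>UNIV. \<Sum>j\<in>UNIV. (M $ i $ j)\<^sup>2)"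
  by (simp add: norm_vec_def L2_set_def sum_nonneg real_sqrt_pow2)

lemma norm_transpose: "norm (transpose M) = norm (M :: real^'n^'m)"
proof -
  have "(norm (transpose M))\<^sup>2 = (norm M)\<^sup>2"
    unfolding norm_matrix_power2 transpose_def by (simp add: sum.swap[of _ "UNIV :: 'n set"])
  then show ?thesis by simp
qed

lemma norm_matrix_mult_le: "norm (A ** B) \<le> norm A * norm (B :: real^'p^'n)"
  for A :: "real^'n^'m"
proof -
  have "((A ** B) $ i $ j)\<^sup>2 \<le> (norm (A $ i))\<^sup>2 * (norm (transpose B $ j))\<^sup>2" for i j
  proof -
    have "(A ** B) $ i $ j = A $ i \<bullet> transpose B $ j"
      by (simp add: matrix_matrix_mult_def transpose_def inner_vec_def)
    then have "\<bar>(A ** B) $ i $ j\<bar> \<le> norm (A $ i) * norm (transpose B $ j)"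
      by (metis Cauchy_Schwarz_ineq2)
    then have "\<bar>(A ** B) $ i $ j\<bar>\<^sup>2 \<le> (norm (A $ i) * norm (transpose B $ j))\<^sup>2"
      by (intro power_mono) auto
    then show ?thesis by (simp add: power_mult_distrib)
  qed
  then have "(norm (A ** B))\<^sup>2 \<le> (\<Sum>i\<in>UNIV. \<Sum>j\<in>UNIV. (norm (A $ i))\<^sup>2 * (norm (transpose B $ j))\<^sup>2)"
    unfolding norm_matrix_power2 by (intro sum_mono)
  also have "\<dots> = (\<Sum>i\<in>UNIV. (norm (A $ i))\<^sup>2) * (\<Sum>j\<in>UNIV. (norm (transpose B $ j))\<^sup>2)"
    by (rule sum_product[symmetric])
  also have "\<dots> = (norm A)\<^sup>2 * (norm (transpose B))\<^sup>2"
    by (simp add: norm_vec_def[of A] norm_vec_def[of "transpose B"] L2_set_def sum_nonneg)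
  finally have "(norm (A ** B))\<^sup>2 \<le> (norm A * norm B)\<^sup>2"
    by (simp add: norm_transpose power_mult_distrib)
  then show ?thesis by (rule power2_le_imp_le) simp
qed

lemma norm_matrix_vector_mult_le: "norm (A *v x) \<le> norm A * norm x"
  for A :: "real^'n^'m" and x :: "real^'n"
proof (rule power2_le_imp_le)
  have comp: "((A *v x) $ i)\<^sup>2 \<le> (norm (A $ i))\<^sup>2 * (norm x)\<^sup>2" for i
  proof -
    have "\<bar>A $ i \<bullet> x\<bar> \<le> norm (A $ i) * norm x" by (rule Cauchy_Schwarz_ineq2)
    then have "\<bar>A $ i \<bullet> x\<bar>\<^sup>2 \<le> (norm (A $ i) * norm x)\<^sup>2" by (intro power_mono) auto
    then show ?thesis by (simp add: matrix_vector_mul_component power_mult_distrib)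
  qed
  have "(norm (A *v x))\<^sup>2 = (\<Sum>i\<in>UNIV. ((A *v x) $ i)\<^sup>2)"
    by (simp add: norm_vec_def L2_set_def sum_nonneg)
  also have "\<dots> \<le> (\<Sum>i\<in>UNIV. (norm (A $ i))\<^sup>2 * (norm x)\<^sup>2)"
    by (intro sum_mono comp)
  also have "\<dots> = (norm A * norm x)\<^sup>2"
    by (simp add: norm_vec_def[of A] L2_set_def sum_nonneg sum_distrib_right power_mult_distrib)
  finally show "(norm (A *v x))\<^sup>2 \<le> (norm A * norm x)\<^sup>2" .
qed simp

lemma transpose_add: "transpose (A + B) = transpose A + transpose B"
  by (simp add: transpose_def vec_eq_iff)

lemma transpose_minus: "transpose (A - B) = transpose A - transpose B"
  for A :: "'a::group_add^'n^'m"
  by (simp add: transpose_def vec_eq_iff)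

lemma matrix_mult_diff_distrib:
  fixes A B C :: "real^'n^'n"
  shows "(A - B) ** C = A ** C - B ** C" "C ** (A - B) = C ** A - C ** B"
  by (simp_all add: matrix_matrix_mult_def vec_eq_iff sum_subtractf algebra_simps)

lemma matrix_add_rdistrib: "(A + B) ** C = A ** C + B ** C"
  for A B :: "real^'n^'m" and C :: "real^'p^'n"
  by (simp add: matrix_matrix_mult_def vec_eq_iff sum.distrib algebra_simps)

text \<open>For symmetric M this is the only upper triangular X with X + X^T = M: the derivative of
  the Cholesky factor at the identity in direction M.\<close>

definition upper_half :: "'n::{finite,linorder} matrix \<Rightarrow> 'n matrix" where
  "upper_half M = (\<chi> i j. if i < j then M $ i $ j else if i = j then M $ i $ j / 2 else 0)"

lemma norm_upper_half: "norm (upper_half M) \<le> norm M"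
proof (rule power2_le_imp_le)
  show "(norm (upper_half M))\<^sup>2 \<le> (norm M)\<^sup>2"
    unfolding norm_matrix_power2
    by (intro sum_mono) (auto simp: upper_half_def power2_eq_square)
qed simp

lemma upper_half_diff: "upper_half (A - B) = upper_half A - upper_half B"
  by (simp add: upper_half_def vec_eq_iff diff_divide_distrib)

lemma upper_half_symmetric:
  assumes "transpose M = M"
  shows "upper_half M + transpose (upper_half M) = M"
proof -
  have "M $ i $ j = M $ j $ i" for i j
    using arg_cong[OF assms, of "\<lambda>A. A $ j $ i"] by (simp add: transpose_def)
  then show ?thesis by (auto simp: upper_half_def transpose_def vec_eq_iff)
qed

text \<open>
  \<open>(I + X)\<^sup>T (I + X) = I + E\<close> with \<open>X\<close> upper triangular is the fixed point equation
  \<open>X = upper_half (E - X\<^sup>T X)\<close>, a contraction near \<open>0\<close>.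
\<close>

lemma cholesky_near_identity:
  fixes E :: "'n::{finite,linorder} matrix"
  assumes sym: "transpose E = E" and E: "norm E \<le> e" "e \<le> 1 / 8"
  shows "\<exists>X. (\<forall>i j. j < i \<longrightarrow> X $ i $ j = 0) \<and> norm X \<le> 2 * e \<and>
    transpose (mat 1 + X) ** (mat 1 + X) = mat 1 + E"
proof -
  define T where "T = (\<lambda>X :: 'n matrix. upper_half (E - transpose X ** X))"
  let ?S = "cball (0 :: 'n matrix) (2 * e)"
  have e: "0 \<le> e" using E norm_ge_zero[of E] by linarith
  \<comment> \<open>The radius 2e is at most 1/4, and X^T X - Y^T Y has norm at most (|X| + |Y|) |X
    - Y|; this gives the factor 1/2. The ball is preserved because |X^T X| \<le> 4 e^2 \<le>
    e.\<close>
  have "\<exists>!X. X \<in> ?S \<and> T X = X"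
  proof (rule Banach_fix[where c = "1 / 2"])
    show "T ` ?S \<subseteq> ?S"
    proof clarify
      fix X :: "'n matrix" assume "X \<in> ?S"
      then have X: "norm X \<le> 2 * e" by simp
      have "norm (transpose X ** X) \<le> norm X * norm X"
        using norm_matrix_mult_le[of "transpose X" X] by (simp add: norm_transpose)
      also have "\<dots> \<le> (2 * e) * (2 * e)" using X e by (intro mult_mono) auto
      also have "\<dots> \<le> e"
      proof -
        have "e * e \<le> 1 / 8 * e" by (rule mult_right_mono[OF E(2) e])
        moreover have "0 \<le> e * e" by simp
        ultimately show ?thesis by linarith
      qed
      finally have "norm (E - transpose X ** X) \<le> 2 * e"
        using norm_triangle_ineq4[of E "transpose X ** X"] E(1) by linarith
      then show "T X \<in> ?S" using norm_upper_half[of "E - transpose X ** X"] by (simp add: T_def)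
    qed
  next
    fix X Y assume "X \<in> ?S" "Y \<in> ?S"
    then have XY: "norm X \<le> 1 / 4" "norm Y \<le> 1 / 4" using E(2) by auto
    have "T X - T Y = upper_half (transpose Y ** (Y - X) + transpose (Y - X) ** X)"
      unfolding T_def upper_half_diff[symmetric]
      by (simp add: matrix_mult_diff_distrib transpose_minus)
    then have "norm (T X - T Y) \<le> norm (transpose Y ** (Y - X)) + norm (transpose (Y - X) ** X)"
      by (metis norm_upper_half norm_triangle_ineq order_trans)
    also have "\<dots> \<le> norm Y * norm (Y - X) + norm (Y - X) * norm X"
      by (intro add_mono order_trans[OF norm_matrix_mult_le]) (simp_all add: norm_transpose)
    also have "\<dots> \<le> 1 / 4 * norm (Y - X) + norm (Y - X) * (1 / 4)"
      using XY by (intro add_mono mult_mono) auto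
    finally show "dist (T X) (T Y) \<le> 1 / 2 * dist X Y"
      by (simp add: dist_norm norm_minus_commute)
  qed (use e in \<open>auto simp: compact_imp_complete\<close>)
  then obtain X where X: "norm X \<le> 2 * e" "T X = X" by auto
  have "transpose (E - transpose X ** X) = E - transpose X ** X"
    by (simp add: transpose_minus sym matrix_transpose_mul)
  from upper_half_symmetric[OF this] have "X + transpose X = E - transpose X ** X"
    using X(2) unfolding T_def by simp
  then have "transpose (mat 1 + X) ** (mat 1 + X) = mat 1 + E"
    by (simp add: transpose_add matrix_add_ldistrib matrix_add_rdistrib algebra_simps)
  moreover have "X $ i $ j = 0" if "j < i" for i j
  proof -
    have "T X $ i $ j = 0" using that unfolding T_def upper_half_def by auto
    then show ?thesis unfolding X(2) .
  qed
  ultimately show ?thesis using X(1) by blast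
qed

text \<open>Rows are determined one after the other by the Gram matrix.\<close>

lemma upper_triangular_gram_unique:
  fixes U U' :: "'n::{finite,linorder} matrix"
  assumes U: "\<And>i j. j < i \<Longrightarrow> U $ i $ j = 0" "\<And>i. 0 < U $ i $ i"
    and U': "\<And>i j. j < i \<Longrightarrow> U' $ i $ j = 0" "\<And>i. 0 < U' $ i $ i"
    and gram: "transpose U ** U = transpose U' ** U'"
  shows "U = U'"
proof -
  \<comment> \<open>The number of rows above i is the induction measure. Once those rows agree, the
    Gram entry (i, l) determines U_ii U_il; l = i gives the diagonal entry by positivity, and
    dividing by it gives the row.\<close>
  have "U $ i $ j = U' $ i $ j" for i j
  proof (induction "card {k. k < i}" arbitrary: i j rule: less_induct)
    case less
    have IH: "U $ k $ l = U' $ k $ l" if "k < i" for k l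
    proof (rule less)
      show "card {l. l < k} < card {k. k < i}"
        using that by (intro psubset_card_mono) auto
    qed
    have split: "(\<Sum>k\<in>UNIV. V $ k $ i * V $ k $ l) = (\<Sum>k | k < i. V $ k $ i * V $ k $ l) + V $ i $ i * V $ i $ l"
      if "\<And>i j. j < i \<Longrightarrow> V $ i $ j = 0" for V :: "'n matrix" and l
    proof -
      have "(\<Sum>k\<in>UNIV. V $ k $ i * V $ k $ l) = (\<Sum>k\<in>insert i {k. k < i}. V $ k $ i * V $ k $ l)"
        by (rule sum.mono_neutral_right) (auto intro!: that)
      then show ?thesis by simp
    qed
    have eq: "U $ i $ i * U $ i $ l = U' $ i $ i * U' $ i $ l" for l
    proof -
      have "(transpose U ** U) $ i $ l = (transpose U' ** U') $ i $ l" by (simp add: gram)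
      then have "(\<Sum>k\<in>UNIV. U $ k $ i * U $ k $ l) = (\<Sum>k\<in>UNIV. U' $ k $ i * U' $ k $ l)"
        by (simp add: matrix_matrix_mult_def transpose_def)
      moreover have "(\<Sum>k | k < i. U $ k $ i * U $ k $ l) = (\<Sum>k | k < i. U' $ k $ i * U' $ k $ l)"
        by (rule sum.cong) (auto simp: IH)
      ultimately show ?thesis using split[OF U(1)] split[OF U'(1)] by simp
    qed
    have "(U $ i $ i)\<^sup>2 = (U' $ i $ i)\<^sup>2" using eq[of i] by (simp add: power2_eq_square)
    then have "U $ i $ i = U' $ i $ i" using U(2)[of i] U'(2)[of i] by (simp add: power2_eq_iff_nonneg less_imp_le)
    with eq[of j] U(2)[of i] show ?case by simp
  qed
  then show ?thesis by (simp add: vec_eq_iff)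
qed

text \<open>The Gram matrix M^T M = U^T U does not see the orthogonal factor, so it fixes the
  triangular one. The right inverse \<open>V\<close> cancels that factor and leaves Q.\<close>

lemma qf_eqI:
  fixes M Q U V :: "'n::{finite,linorder} matrix"
  assumes Q: "orthogonal_matrix Q" and U: "\<And>i j. j < i \<Longrightarrow> U $ i $ j = 0" "\<And>i. 0 < U $ i $ i"
    and M: "M = Q ** U" and inv: "U ** V = mat 1"
  shows "qf M = Q"
  unfolding qf_def
proof (rule the_equality)
  show "orthogonal_matrix Q \<and> (\<exists>U. (\<forall>i j. j < i \<longrightarrow> U $ i $ j = 0) \<and> (\<forall>i. 0 < U $ i $ i) \<and> M = Q ** U)"
    using assms by blast
next
  fix Q'
  assume "orthogonal_matrix Q' \<and> (\<exists>U. (\<forall>i j. j < i \<longrightarrow> U $ i $ j = 0) \<and> (\<forall>i. 0 < U $ i $ i) \<and> M = Q' ** U)"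
  then obtain U' where Q': "orthogonal_matrix Q'" and U': "\<And>i j. j < i \<Longrightarrow> U' $ i $ j = 0" "\<And>i. 0 < U' $ i $ i"
    and M': "M = Q' ** U'" by blast
  have gram: "transpose (Q ** U) ** (Q ** U) = transpose U ** U"
    if "orthogonal_matrix Q" for Q U :: "'n matrix"
  proof -
    have "transpose (Q ** U) ** (Q ** U) = transpose U ** (transpose Q ** Q) ** U"
      by (simp add: matrix_transpose_mul matrix_mul_assoc)
    then show ?thesis using that by (simp add: orthogonal_matrix)
  qed
  have "transpose U ** U = transpose U' ** U'"
    using gram[OF Q, of U] gram[OF Q', of U'] M M' by simp
  from upper_triangular_gram_unique[OF U U' this] have "Q ** U = Q' ** U" using M M' by simp
  then have "Q ** U ** V = Q' ** U ** V" by simp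
  then show "Q' = Q" by (simp add: matrix_mul_assoc[symmetric] inv)
qed

lemma norm_orthogonal_matrix_le:
  fixes Q :: "real^'n^'n"
  assumes "orthogonal_matrix Q"
  shows "norm Q \<le> (real CARD('n))\<^sup>2"
proof -
  have "\<bar>Q $ i $ j\<bar> \<le> 1" for i j
    using assms component_le_norm_cart[of "row i Q" j]
    by (simp add: orthogonal_matrix_orthonormal_rows row_def)
  from norm_matrix_le_entries[OF this] show ?thesis by simp
qed

text \<open>
  On tangent vectors the Gram matrix of \<open>Q + \<xi>\<close> is \<open>I + \<xi>\<^sup>T \<xi>\<close>, so the triangular factor
  differs from \<open>I\<close> only to second order.
\<close>

lemma retract_Orth_estimate:
  fixes Q :: "'n::{finite,linorder} matrix"
  assumes Q: "orthogonal_matrix Q" and \<zeta>: "\<zeta> \<in> tangent_Orth Q" and h: "norm \<zeta> \<le> h" "h \<le> 1 / 4"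
  shows "norm (qf (Q + \<zeta>) - Q - \<zeta>) \<le> 2 * (real CARD('n))\<^sup>2 * h\<^sup>2"
proof -
  let ?E = "transpose \<zeta> ** \<zeta>"
  have h0: "0 \<le> h" using h norm_ge_zero[of \<zeta>] by linarith
  have "norm ?E \<le> norm \<zeta> * norm \<zeta>" using norm_matrix_mult_le[of "transpose \<zeta>" \<zeta>] by (simp add: norm_transpose)
  also have "\<dots> \<le> h\<^sup>2" using h h0 by (simp add: power2_eq_square mult_mono)
  finally have "norm ?E \<le> h\<^sup>2" .
  moreover have "h\<^sup>2 \<le> (1 / 4)\<^sup>2" using h h0 by (intro power_mono)
  then have h2: "h\<^sup>2 \<le> 1 / 8" by (simp add: power2_eq_square)
  moreover have "transpose ?E = ?E" by (simp add: matrix_transpose_mul)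
  ultimately obtain X where X: "\<And>i j. j < i \<Longrightarrow> X $ i $ j = 0" "norm X \<le> 2 * h\<^sup>2"
    and gram: "transpose (mat 1 + X) ** (mat 1 + X) = mat 1 + ?E"
    using cholesky_near_identity[of ?E "h\<^sup>2"] by auto
  define U where "U = mat 1 + X"
  \<comment> \<open>Since |X| \<le> 2 h^2 \<le> 1/4, the matrix I + X has trivial kernel, hence the
    inverse that defines \<open>Q'\<close>.\<close>
  have "U *v x \<noteq> 0" if "x \<noteq> 0" for x
  proof
    assume "U *v x = 0"
    then have "x = - (X *v x)" by (simp add: U_def matrix_vector_mult_add_rdistrib eq_neg_iff_add_eq_0)
    then have "norm x = norm (X *v x)" by (metis norm_minus_cancel)
    also have "\<dots> \<le> norm X * norm x" by (rule norm_matrix_vector_mult_le)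
    finally have "norm x \<le> norm X * norm x" .
    moreover have "norm X * norm x \<le> 1 / 4 * norm x" using X(2) h2 by (intro mult_right_mono) auto
    ultimately show False using that by simp
  qed
  then obtain V where VU: "V ** U = mat 1" using matrix_left_invertible_ker[of U] by blast
  then have UV: "U ** V = mat 1" using matrix_left_right_inverse by blast
  define Q' where "Q' = (Q + \<zeta>) ** V"
  have QU: "Q' ** U = Q + \<zeta>" by (simp add: Q'_def matrix_mul_assoc[symmetric] VU)
  have "transpose (Q + \<zeta>) ** (Q + \<zeta>) =
      transpose Q ** Q + (transpose Q ** \<zeta> + transpose \<zeta> ** Q) + ?E"
    by (simp add: transpose_add matrix_add_ldistrib matrix_add_rdistrib add.assoc)
  also have "\<dots> = transpose U ** U"
    using Q \<zeta> unfolding U_def gram by (simp add: orthogonal_matrix tangent_Orth_def)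
  finally have gramQ: "transpose (Q + \<zeta>) ** (Q + \<zeta>) = transpose U ** U" .
  have "transpose Q' ** Q' = transpose V ** (transpose (Q + \<zeta>) ** (Q + \<zeta>)) ** V"
    by (simp only: Q'_def matrix_transpose_mul matrix_mul_assoc)
  also have "\<dots> = transpose V ** (transpose U ** U) ** V" by (simp only: gramQ)
  also have "\<dots> = transpose (U ** V) ** (U ** V)"
    by (simp only: matrix_transpose_mul matrix_mul_assoc)
  finally have Q': "orthogonal_matrix Q'" by (simp add: UV orthogonal_matrix)
  have "0 < U $ i $ i" for i
    using entry_le_norm[of X i i] X(2) h2 by (simp add: U_def mat_def)
  moreover have "U $ i $ j = 0" if "j < i" for i j using that X(1) by (simp add: U_def mat_def)
  ultimately have "qf (Q + \<zeta>) = Q'" by (intro qf_eqI[OF Q' _ _ QU[symmetric] UV])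
  \<comment> \<open>As Q' (I + X) = Q + \<zeta>, the whole error is Q' X, and X is already of second
    order.\<close>
  moreover have "Q' - Q - \<zeta> = - (Q' ** X)"
    using QU by (simp add: U_def matrix_add_ldistrib algebra_simps)
  ultimately have "norm (qf (Q + \<zeta>) - Q - \<zeta>) \<le> norm Q' * norm X"
    by (simp add: norm_matrix_mult_le)
  also have "\<dots> \<le> (real CARD('n))\<^sup>2 * (2 * h\<^sup>2)"
    using norm_orthogonal_matrix_le[OF Q'] X(2) by (intro mult_mono) auto
  finally show ?thesis by simp
qed

section \<open>First-order expansion of the retraction\<close>

text \<open>Base points and directions both vary with k. What carries the limit is a remainder
  constant \<open>K\<close> that does not depend on k.\<close>

lemma second_order_quotient:
  fixes R C \<xi> :: "nat \<Rightarrow> 'a::real_normed_vector"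
  assumes t: "\<And>k. 0 < t k" "t \<longlonglongrightarrow> 0" and \<xi>: "\<xi> \<longlonglongrightarrow> \<xi>0"
    and est: "\<forall>\<^sub>F k in sequentially. norm (R k - C k - t k *\<^sub>R \<xi> k) \<le> K * (t k)\<^sup>2"
  shows "(\<lambda>k. (R k - C k) /\<^sub>R t k) \<longlonglongrightarrow> \<xi>0"
proof -
  have "(\<lambda>k. (R k - C k - t k *\<^sub>R \<xi> k) /\<^sub>R t k) \<longlonglongrightarrow> 0"
  proof (rule Lim_null_comparison)
    show "\<forall>\<^sub>F k in sequentially. norm ((R k - C k - t k *\<^sub>R \<xi> k) /\<^sub>R t k) \<le> K * t k"
      using est
    proof eventually_elim
      case (elim k)
      have "norm ((R k - C k - t k *\<^sub>R \<xi> k) /\<^sub>R t k) = norm (R k - C k - t k *\<^sub>R \<xi> k) / t k"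
        unfolding norm_scaleR using t(1)[of k] by (simp add: divide_inverse_commute)
      also have "\<dots> \<le> K * (t k)\<^sup>2 / t k" using elim t(1)[of k] by (intro divide_right_mono) auto
      finally show ?case using t(1)[of k] by (simp add: power2_eq_square)
    qed
    show "(\<lambda>k. K * t k) \<longlonglongrightarrow> 0" using tendsto_mult_right_zero[OF t(2)] by simp
  qed
  from tendsto_add[OF this \<xi>]
  have "(\<lambda>k. (R k - C k - t k *\<^sub>R \<xi> k) /\<^sub>R t k + \<xi> k) \<longlonglongrightarrow> \<xi>0" by simp
  then show ?thesis
    using t(1) by (simp add: algebra_simps less_imp_neq[symmetric])
qed

lemma convergent_norm_bound:
  fixes \<xi> :: "nat \<Rightarrow> 'a::real_normed_vector"
  assumes "\<xi> \<longlonglongrightarrow> \<xi>0"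
  obtains M where "0 < M" "\<And>k. norm (\<xi> k) \<le> M"
  using Bseq_def convergent_imp_Bseq assms convergentI by metis

lemma retract_DP_quotient:
  assumes C: "\<And>k. C k \<in> DP" "C \<longlonglongrightarrow> C0" "C0 \<in> DP"
    and \<xi>: "\<And>k. \<xi> k \<in> tangent_DP" "\<xi> \<longlonglongrightarrow> \<xi>0"
    and t: "\<And>k. 0 < t k" "t \<longlonglongrightarrow> 0"
  shows "(\<lambda>k. (retract_DP (C k) (t k *\<^sub>R \<xi> k) - C k) /\<^sub>R t k) \<longlonglongrightarrow> (\<xi>0 :: real^'n^'n)"
proof -
  obtain M where M: "0 < M" "\<And>k. norm (\<xi> k) \<le> M" using convergent_norm_bound[OF \<xi>(2)] by blast
  let ?E = "range (\<lambda>(i, j). C0 $ i $ j)"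
  \<comment> \<open>Half the smallest entry of the limit bounds the entries of \<open>C k\<close>
    from below for all large k, which makes the constant of \<open>retract_DP_estimate\<close>
    uniform; the cap 1 meets its hypothesis \<open>m \<le> 1\<close>.\<close>
  define m where "m = min 1 (Min ?E / 2)"
  have "0 < Min ?E" using C(3) by (subst Min_gr_iff) (auto simp: DP_iff)
  then have m: "0 < m" "m \<le> 1" by (auto simp: m_def)
  have "m < C0 $ i $ j" for i j
  proof -
    have "Min ?E \<le> C0 $ i $ j" by (rule Min_le) auto
    moreover have "m \<le> Min ?E / 2" unfolding m_def by (rule min.cobounded2)
    ultimately show ?thesis using \<open>0 < Min ?E\<close> by linarith
  qed
  then have "\<forall>\<^sub>F k in sequentially. m < C k $ i $ j" for i j
    using order_tendstoD(1)[OF tendsto_vec_nth[OF tendsto_vec_nth[OF C(2)]]] by blast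
  then have mC: "\<forall>\<^sub>F k in sequentially. \<forall>i j. m < C k $ i $ j"
    by (simp add: eventually_all_finite)
  let ?n = "real CARD('n)"
  define d where "d = m\<^sup>2 / (80 * ?n)"
  have "0 < d" using m by (simp add: d_def)
  then have small: "\<forall>\<^sub>F k in sequentially. M * t k < d"
    using order_tendstoD(2)[OF tendsto_mult_right_zero[OF t(2), of M]] by simp
  show ?thesis
  proof (rule second_order_quotient[OF t \<xi>(2), where K = "500 * ?n ^ 3 / m\<^sup>2 * M\<^sup>2"])
    show "\<forall>\<^sub>F k in sequentially. norm (retract_DP (C k) (t k *\<^sub>R \<xi> k) - C k - t k *\<^sub>R \<xi> k)
        \<le> 500 * ?n ^ 3 / m\<^sup>2 * M\<^sup>2 * (t k)\<^sup>2"
      using mC small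
    proof eventually_elim
      case (elim k)
      have "t k *\<^sub>R \<xi> k \<in> tangent_DP"
        using \<xi>(1)[of k] by (simp add: tangent_DP_iff sum_distrib_left[symmetric])
      moreover have "norm (t k *\<^sub>R \<xi> k) \<le> M * t k"
        using M(2)[of k] t(1)[of k] by (simp add: mult.commute)
      moreover have "0 < M * t k" using M t(1) by simp
      moreover have "m \<le> C k $ i $ j" for i j using elim(1) by (simp add: less_imp_le)
      ultimately have "norm (retract_DP (C k) (t k *\<^sub>R \<xi> k) - C k - t k *\<^sub>R \<xi> k)
          \<le> 500 * ?n ^ 3 / m\<^sup>2 * (M * t k)\<^sup>2"
        using elim(2) C(1) m unfolding d_def by (intro retract_DP_estimate) auto
      then show ?case by (simp add: power_mult_distrib mult.assoc)
    qed
  qed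
qed

lemma retract_Orth_quotient:
  assumes Q: "\<And>k. orthogonal_matrix (Q k)"
    and \<xi>: "\<And>k. \<xi> k \<in> tangent_Orth (Q k)" "\<xi> \<longlonglongrightarrow> \<xi>0"
    and t: "\<And>k. 0 < t k" "t \<longlonglongrightarrow> 0"
  shows "(\<lambda>k. (qf (Q k + t k *\<^sub>R \<xi> k) - Q k) /\<^sub>R t k) \<longlonglongrightarrow> (\<xi>0 :: 'n::{finite,linorder} matrix)"
proof -
  obtain M where M: "0 < M" "\<And>k. norm (\<xi> k) \<le> M" using convergent_norm_bound[OF \<xi>(2)] by blast
  have small: "\<forall>\<^sub>F k in sequentially. M * t k < 1 / 4"
    using order_tendstoD(2)[OF tendsto_mult_right_zero[OF t(2), of M], of "1 / 4"] by simp
  let ?n = "real CARD('n)"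
  show ?thesis
  proof (rule second_order_quotient[OF t \<xi>(2), where K = "2 * ?n\<^sup>2 * M\<^sup>2"])
    show "\<forall>\<^sub>F k in sequentially. norm (qf (Q k + t k *\<^sub>R \<xi> k) - Q k - t k *\<^sub>R \<xi> k)
        \<le> 2 * ?n\<^sup>2 * M\<^sup>2 * (t k)\<^sup>2"
      using small
    proof eventually_elim
      case (elim k)
      have "transpose (Q k) ** (t k *\<^sub>R \<xi> k) + transpose (t k *\<^sub>R \<xi> k) ** Q k =
         t k *\<^sub>R (transpose (Q k) ** \<xi> k + transpose (\<xi> k) ** Q k)"
        by (simp add: vec_eq_iff matrix_matrix_mult_def transpose_def sum_distrib_left algebra_simps)
      then have "t k *\<^sub>R \<xi> k \<in> tangent_Orth (Q k)"
        using \<xi>(1)[of k] by (simp add: tangent_Orth_def)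
      moreover have "norm (t k *\<^sub>R \<xi> k) \<le> M * t k"
        using M(2)[of k] t(1)[of k] by (simp add: mult.commute)
      ultimately have "norm (qf (Q k + t k *\<^sub>R \<xi> k) - Q k - t k *\<^sub>R \<xi> k) \<le> 2 * ?n\<^sup>2 * (M * t k)\<^sup>2"
        using elim Q by (intro retract_Orth_estimate) auto
      then show ?case by (simp add: power_mult_distrib mult.assoc)
    qed
  qed
qed

lemma tendsto_matrixI:
  fixes f :: "'a \<Rightarrow> real^'n^'m"
  assumes "\<And>i j. ((\<lambda>x. f x $ i $ j) \<longlongrightarrow> L $ i $ j) F"
  shows "(f \<longlongrightarrow> L) F"
  by (intro vec_tendstoI assms)

lemma Wset_pos: "W \<in> Wset s \<Longrightarrow> (i, j) \<in> I2 s \<Longrightarrow> 0 < W $ i $ j"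
  unfolding Wset_def by (metis (mono_tags, lifting) mem_Collect_eq)

lemma retract_W_quotient:
  assumes W: "\<And>k. W k \<in> Wset s" "W \<longlonglongrightarrow> W0" "W0 \<in> Wset s"
    and \<xi>: "\<And>k. \<xi> k \<in> tangent_W s" "\<xi> \<longlonglongrightarrow> \<xi>0"
    and t: "\<And>k. 0 < t k" "t \<longlonglongrightarrow> 0"
  shows "(\<lambda>k. (retract_W s (W k) (t k *\<^sub>R \<xi> k) - W k) /\<^sub>R t k) \<longlonglongrightarrow> (\<xi>0 :: 'n::{finite,linorder} matrix)"
proof (rule tendsto_matrixI)
  fix i j
  have lim: "(\<lambda>k. \<xi> k $ i $ j) \<longlonglongrightarrow> \<xi>0 $ i $ j" by (intro tendsto_intros \<xi>)
  show "(\<lambda>k. ((retract_W s (W k) (t k *\<^sub>R \<xi> k) - W k) /\<^sub>R t k) $ i $ j) \<longlonglongrightarrow> \<xi>0 $ i $ j"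
  proof (cases "(i, j) \<in> I2 s")
    case True
    obtain M where M: "0 < M" "\<And>k. norm (\<xi> k) \<le> M" using convergent_norm_bound[OF \<xi>(2)] by blast
    define m where "m = W0 $ i $ j / 2"
    have m: "0 < m" using Wset_pos[OF W(3) True] by (simp add: m_def)
    then have "m < W0 $ i $ j" by (simp add: m_def)
    then have mW: "\<forall>\<^sub>F k in sequentially. m < W k $ i $ j"
      using order_tendstoD(1)[OF tendsto_vec_nth[OF tendsto_vec_nth[OF W(2)]]] by blast
    have small: "\<forall>\<^sub>F k in sequentially. M * t k < m / 2"
      using order_tendstoD(2)[OF tendsto_mult_right_zero[OF t(2), of M], of "m / 2"] m by simp
    have "(\<lambda>k. (retract_W s (W k) (t k *\<^sub>R \<xi> k) $ i $ j - W k $ i $ j) /\<^sub>R t k) \<longlonglongrightarrow> \<xi>0 $ i $ j"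
    proof (rule second_order_quotient[OF t lim, where K = "M\<^sup>2 / m"])
      show "\<forall>\<^sub>F k in sequentially. norm (retract_W s (W k) (t k *\<^sub>R \<xi> k) $ i $ j - W k $ i $ j - t k *\<^sub>R \<xi> k $ i $ j)
        \<le> M\<^sup>2 / m * (t k)\<^sup>2"
        using mW small
      proof eventually_elim
        case (elim k)
        have "\<bar>t k * \<xi> k $ i $ j\<bar> \<le> M * t k"
          using M(2)[of k] entry_le_norm[of "\<xi> k" i j] t(1)[of k]
          by (simp add: abs_mult mult.commute)
        then have "\<bar>W k $ i $ j * exp ((t k * \<xi> k $ i $ j) / W k $ i $ j) - W k $ i $ j - t k * \<xi> k $ i $ j\<bar>
            \<le> (M * t k)\<^sup>2 / m"
          using elim m by (intro exp_entry_estimate) auto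
        then show ?case using True by (simp add: retract_W_def power_mult_distrib)
      qed
    qed
    then show ?thesis by simp
  next
    case False
    then have "W k $ i $ j = 0" "\<xi> k $ i $ j = 0" for k
      using W(1)[of k] \<xi>(1)[of k] by (auto simp: Wset_def tangent_W_def)
    then show ?thesis using False lim by (simp add: retract_W_def)
  qed
qed

text \<open>The differential of a retraction at the zero vector is the identity; here in a form that
  lets the base point move. The \<open>V\<close> component is exact.\<close>

lemma retract_quotient:
  fixes Z \<xi> :: "nat \<Rightarrow> 'n::{finite,linorder} point"
  assumes Z: "\<And>k. Z k \<in> Zman s" "Z \<longlonglongrightarrow> Z0" "Z0 \<in> Zman s"
    and \<xi>: "\<And>k. \<xi> k \<in> tangent s (Z k)" "\<xi> \<longlonglongrightarrow> \<xi>0"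
    and t: "\<And>k. 0 < t k" "t \<longlonglongrightarrow> 0"
  shows "(\<lambda>k. (retract s (Z k) (t k *\<^sub>R \<xi> k) - Z k) /\<^sub>R t k) \<longlonglongrightarrow> \<xi>0"
proof -
  obtain C0 Q0 W0 V0 where Z0: "Z0 = (C0, Q0, W0, V0)" by (cases Z0) auto
  obtain a0 b0 c0 d0 where \<xi>0: "\<xi>0 = (a0, b0, c0, d0)" by (cases \<xi>0) auto
  define C Q W V where "C = (\<lambda>k. fst (Z k))" and "Q = (\<lambda>k. fst (snd (Z k)))"
    and "W = (\<lambda>k. fst (snd (snd (Z k))))" and "V = (\<lambda>k. snd (snd (snd (Z k))))"
  define a b c d where "a = (\<lambda>k. fst (\<xi> k))" and "b = (\<lambda>k. fst (snd (\<xi> k)))"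
    and "c = (\<lambda>k. fst (snd (snd (\<xi> k))))" and "d = (\<lambda>k. snd (snd (snd (\<xi> k))))"
  have Zk: "Z k = (C k, Q k, W k, V k)" for k by (simp add: C_def Q_def W_def V_def)
  have \<xi>k: "\<xi> k = (a k, b k, c k, d k)" for k by (simp add: a_def b_def c_def d_def)
  have limZ: "C \<longlonglongrightarrow> C0" "W \<longlonglongrightarrow> W0"
    using tendsto_fst[OF Z(2)] tendsto_fst[OF tendsto_snd[OF tendsto_snd[OF Z(2)]]]
    by (simp_all add: Z0 C_def W_def)
  have lim\<xi>: "a \<longlonglongrightarrow> a0" "b \<longlonglongrightarrow> b0" "c \<longlonglongrightarrow> c0" "d \<longlonglongrightarrow> d0"
    using tendsto_fst[OF \<xi>(2)] tendsto_fst[OF tendsto_snd[OF \<xi>(2)]]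
      tendsto_fst[OF tendsto_snd[OF tendsto_snd[OF \<xi>(2)]]] tendsto_snd[OF tendsto_snd[OF tendsto_snd[OF \<xi>(2)]]]
    by (simp_all add: \<xi>0 a_def b_def c_def d_def)
  have mem: "C k \<in> DP" "orthogonal_matrix (Q k)" "W k \<in> Wset s" for k
    using Z(1)[of k] unfolding Zk by (simp_all add: Zman_def Orth_def)
  have mem0: "C0 \<in> DP" "W0 \<in> Wset s" using Z(3) unfolding Z0 by (simp_all add: Zman_def)
  have tan: "a k \<in> tangent_DP" "b k \<in> tangent_Orth (Q k)" "c k \<in> tangent_W s" for k
    using \<xi>(1)[of k] unfolding Zk \<xi>k by (simp_all add: tangent_def)
  have "(\<lambda>k. (retract s (Z k) (t k *\<^sub>R \<xi> k) - Z k) /\<^sub>R t k) =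
     (\<lambda>k. ((retract_DP (C k) (t k *\<^sub>R a k) - C k) /\<^sub>R t k, (qf (Q k + t k *\<^sub>R b k) - Q k) /\<^sub>R t k,
       (retract_W s (W k) (t k *\<^sub>R c k) - W k) /\<^sub>R t k, d k))"
    using t(1) by (simp add: fun_eq_iff retract_def Zk \<xi>k less_imp_neq[symmetric])
  then show ?thesis unfolding \<xi>0
    using retract_DP_quotient[OF mem(1) limZ(1) mem0(1) tan(1) lim\<xi>(1) t]
      retract_Orth_quotient[OF mem(2) tan(2) lim\<xi>(2) t]
      retract_W_quotient[OF mem(3) limZ(2) mem0(2) tan(3) lim\<xi>(3) t] lim\<xi>(4)
    by (auto intro!: tendsto_Pair)
qed

section \<open>Differential of F\<close>

lemma bounded_bilinear_matrix_mult:
  "bounded_bilinear ((**) :: real^'n^'m \<Rightarrow> real^'p^'n \<Rightarrow> real^'p^'m)"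
proof (rule bounded_bilinear.intro)
  show "\<exists>K. \<forall>(A :: real^'n^'m) (B :: real^'p^'n). norm (A ** B) \<le> norm A * norm B * K"
    by (intro exI[of _ 1]) (simp add: norm_matrix_mult_le)
qed (simp_all add: matrix_add_rdistrib matrix_add_ldistrib matrix_matrix_mult_def vec_eq_iff
    sum_distrib_left sum.distrib algebra_simps)

lemma bounded_linear_transpose: "bounded_linear (transpose :: real^'n^'m \<Rightarrow> real^'m^'n)"
  by (intro bounded_linear_intro[where K = 1]) (simp_all add: transpose_add transpose_scalar norm_transpose)

lemmas tendsto_matrix_mult = bounded_bilinear.tendsto[OF bounded_bilinear_matrix_mult]
lemmas tendsto_transpose = bounded_linear.tendsto[OF bounded_linear_transpose]

lemma has_derivative_matrixI:
  fixes f :: "'a::real_normed_vector \<Rightarrow> real^'n^'m"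
  assumes "\<And>i j. ((\<lambda>x. f x $ i $ j) has_derivative (\<lambda>h. f' h $ i $ j)) (at x)"
  shows "(f has_derivative f') (at x)"
  unfolding has_derivative_componentwise_within[of f]
  by (auto simp: Basis_vec_def inner_axis assms)

definition dAmap :: "nat \<Rightarrow> (nat \<Rightarrow> real) \<Rightarrow> 'n::{finite,linorder} matrix \<Rightarrow> 'n matrix \<Rightarrow> 'n matrix" where
  "dAmap s b W \<xi> = (\<chi> i j. if (j, i) \<in> I2 s then (b (pos i div 2))\<^sup>2 * \<xi> $ j $ i / (W $ j $ i)\<^sup>2 else 0)"

lemma has_derivative_Amap:
  assumes "W \<in> Wset s"
  shows "(Amap s b has_derivative dAmap s b W) (at W)"
proof (rule has_derivative_matrixI)
  fix i j
  show "((\<lambda>W. Amap s b W $ i $ j) has_derivative (\<lambda>h. dAmap s b W h $ i $ j)) (at W)"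
  proof (cases "(j, i) \<in> I2 s")
    case True
    then have "W $ j $ i \<noteq> 0" using Wset_pos[OF assms] by fastforce
    have "((\<lambda>W :: 'a matrix. W $ j $ i) has_derivative (\<lambda>h. h $ j $ i)) (at W)"
      by (intro bounded_linear_imp_has_derivative bounded_linear_compose[OF bounded_linear_vec_nth bounded_linear_vec_nth])
    from has_derivative_divide'[OF has_derivative_const[of "- (b (pos i div 2))\<^sup>2"] this] show ?thesis
      using True \<open>W $ j $ i \<noteq> 0\<close> by (simp add: Amap_def dAmap_def power2_eq_square)
  qed (simp add: Amap_def dAmap_def)
qed

lemma tendsto_Amap:
  assumes "W \<longlonglongrightarrow> W0" "W0 \<in> Wset s"
  shows "(\<lambda>k. Amap s b (W k)) \<longlonglongrightarrow> Amap s b W0"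
proof (rule tendsto_matrixI)
  fix i j
  show "(\<lambda>k. Amap s b (W k) $ i $ j) \<longlonglongrightarrow> Amap s b W0 $ i $ j"
    using Wset_pos[OF assms(2), of j i] by (auto simp: Amap_def intro!: tendsto_intros assms)
qed

lemma tendsto_dAmap:
  assumes "W \<longlonglongrightarrow> W0" "W0 \<in> Wset s" "\<xi> \<longlonglongrightarrow> \<xi>0"
  shows "(\<lambda>k. dAmap s b (W k) (\<xi> k)) \<longlonglongrightarrow> dAmap s b W0 \<xi>0"
proof (rule tendsto_matrixI)
  fix i j
  show "(\<lambda>k. dAmap s b (W k) (\<xi> k) $ i $ j) \<longlonglongrightarrow> dAmap s b W0 \<xi>0 $ i $ j"
    using Wset_pos[OF assms(2), of j i] by (auto simp: dAmap_def intro!: tendsto_intros assms)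
qed

text \<open>At a point of the manifold this is a real quasi-triangular Schur form: its 2 x 2
  diagonal blocks have rows (a, w) and (-b^2 / w, a), hence eigenvalues a + bi and a - bi.\<close>

definition schur_factor :: "nat \<Rightarrow> (nat \<Rightarrow> real) \<Rightarrow> (nat \<Rightarrow> real) \<Rightarrow> (nat \<Rightarrow> complex) \<Rightarrow>
    'n::{finite,linorder} point \<Rightarrow> 'n matrix" where
  "schur_factor s a b lam Z = Lambda s a lam + Amap s b (fst (snd (snd Z))) + fst (snd (snd Z)) + snd (snd (snd Z))"

definition dschur_factor :: "nat \<Rightarrow> (nat \<Rightarrow> real) \<Rightarrow> 'n::{finite,linorder} point \<Rightarrow> 'n point \<Rightarrow> 'n matrix" where
  "dschur_factor s b Z \<xi> = dAmap s b (fst (snd (snd Z))) (fst (snd (snd \<xi>))) + fst (snd (snd \<xi>)) + snd (snd (snd \<xi>))"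

lemma Fmap_eq:
  "Fmap s a b lam Z = fst Z - fst (snd Z) ** schur_factor s a b lam Z ** transpose (fst (snd Z))"
  by (cases Z) (simp add: Fmap_def schur_factor_def)

text \<open>Bracketed as the product rule for (Q M) Q^T, to match both the Frechet derivative and
  the sequential quotients.\<close>

definition dFmap :: "nat \<Rightarrow> (nat \<Rightarrow> real) \<Rightarrow> (nat \<Rightarrow> real) \<Rightarrow> (nat \<Rightarrow> complex) \<Rightarrow>
    'n::{finite,linorder} point \<Rightarrow> 'n point \<Rightarrow> 'n matrix" where
  "dFmap s a b lam Z \<xi> = fst \<xi> -
     (fst (snd Z) ** schur_factor s a b lam Z ** transpose (fst (snd \<xi>)) +
      (fst (snd Z) ** dschur_factor s b Z \<xi> + fst (snd \<xi>) ** schur_factor s a b lam Z) ** transpose (fst (snd Z)))"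

lemma Zman_W: "Z \<in> Zman s \<Longrightarrow> fst (snd (snd Z)) \<in> Wset s"
  by (auto simp: Zman_def)

lemma has_derivative_Fmap:
  assumes "Z \<in> Zman s"
  shows "(Fmap s a b lam has_derivative dFmap s a b lam Z) (at Z)"
proof -
  have W: "((\<lambda>Z. fst (snd (snd Z))) has_derivative (\<lambda>h. fst (snd (snd h)))) (at Z)"
    and V: "((\<lambda>Z. snd (snd (snd Z))) has_derivative (\<lambda>h. snd (snd (snd h)))) (at Z)"
    and Q: "((\<lambda>Z. fst (snd Z)) has_derivative (\<lambda>h. fst (snd h))) (at Z)"
    and C: "(fst has_derivative fst) (at Z)"
    for Z :: "'a point"
    by (auto intro!: derivative_eq_intros)
  have "((\<lambda>Z. Amap s b (fst (snd (snd Z)))) has_derivative (\<lambda>h. dAmap s b (fst (snd (snd Z))) (fst (snd (snd h))))) (at Z)"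
    using has_derivative_compose[OF W has_derivative_Amap[OF Zman_W[OF assms]]] .
  then have core: "(schur_factor s a b lam has_derivative dschur_factor s b Z) (at Z)"
    unfolding schur_factor_def dschur_factor_def using W V by (auto intro!: derivative_eq_intros)
  have QT: "((\<lambda>Z. transpose (fst (snd Z))) has_derivative (\<lambda>h. transpose (fst (snd h)))) (at Z)"
    by (rule bounded_linear.has_derivative[OF bounded_linear_transpose Q])
  have "((\<lambda>Z. fst (snd Z) ** schur_factor s a b lam Z) has_derivative
      (\<lambda>h. fst (snd Z) ** dschur_factor s b Z h + fst (snd h) ** schur_factor s a b lam Z)) (at Z)"
    by (rule bounded_bilinear.FDERIV[OF bounded_bilinear_matrix_mult Q core])
  from bounded_bilinear.FDERIV[OF bounded_bilinear_matrix_mult this QT]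
  show ?thesis unfolding Fmap_eq[abs_def] dFmap_def by (rule has_derivative_diff[OF C])
qed

lemma DF_eq: "Z \<in> Zman s \<Longrightarrow> DF s a b lam Z = dFmap s a b lam Z"
  unfolding DF_def by (rule frechet_derivative_at[OF has_derivative_Fmap, symmetric])

lemma linear_dFmap: "Z \<in> Zman s \<Longrightarrow> linear (dFmap s a b lam Z)"
  using has_derivative_Fmap has_derivative_linear by blast

lemma frechet_derivative_objective:
  assumes "Z \<in> Zman s"
  shows "frechet_derivative (objective s a b lam) (at Z) = (\<lambda>\<xi>. dFmap s a b lam Z \<xi> \<bullet> Fmap s a b lam Z)"
proof (rule frechet_derivative_at[symmetric])
  have "((\<lambda>Z. 1 / 2 * (Fmap s a b lam Z \<bullet> Fmap s a b lam Z)) has_derivative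
      (\<lambda>\<xi>. dFmap s a b lam Z \<xi> \<bullet> Fmap s a b lam Z)) (at Z)"
    by (rule derivative_eq_intros has_derivative_Fmap assms)+ (auto simp: inner_commute)
  then show "(objective s a b lam has_derivative (\<lambda>\<xi>. dFmap s a b lam Z \<xi> \<bullet> Fmap s a b lam Z)) (at Z)"
    by (simp add: objective_def[abs_def] power2_norm_eq_inner)
qed

lemma tendsto_schur_factor:
  assumes "Z \<longlonglongrightarrow> Z0" "Z0 \<in> Zman s"
  shows "(\<lambda>k. schur_factor s a b lam (Z k)) \<longlonglongrightarrow> schur_factor s a b lam Z0"
  unfolding schur_factor_def by (intro tendsto_intros tendsto_Amap assms Zman_W)

lemma tendsto_Fmap:
  assumes "Z \<longlonglongrightarrow> Z0" "Z0 \<in> Zman s"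
  shows "(\<lambda>k. Fmap s a b lam (Z k)) \<longlonglongrightarrow> Fmap s a b lam Z0"
  unfolding Fmap_eq by (intro tendsto_intros tendsto_matrix_mult tendsto_transpose tendsto_schur_factor assms)

lemma tendsto_dFmap:
  assumes "Z \<longlonglongrightarrow> Z0" "Z0 \<in> Zman s" "\<xi> \<longlonglongrightarrow> \<xi>0"
  shows "(\<lambda>k. dFmap s a b lam (Z k) (\<xi> k)) \<longlonglongrightarrow> dFmap s a b lam Z0 \<xi>0"
  unfolding dFmap_def dschur_factor_def
  by (intro tendsto_intros tendsto_matrix_mult tendsto_transpose tendsto_schur_factor tendsto_dAmap assms Zman_W)

lemma tendsto_of_quotient:
  fixes x x' :: "nat \<Rightarrow> 'a::real_normed_vector"
  assumes "x \<longlonglongrightarrow> x0" "(\<lambda>k. (x' k - x k) /\<^sub>R t k) \<longlonglongrightarrow> v" "\<And>k. 0 < t k" "t \<longlonglongrightarrow> (0 :: real)"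
  shows "x' \<longlonglongrightarrow> x0"
proof -
  have "(\<lambda>k. x k + t k *\<^sub>R ((x' k - x k) /\<^sub>R t k)) \<longlonglongrightarrow> x0 + 0 *\<^sub>R v"
    by (intro tendsto_intros assms)
  then show ?thesis using assms(3) by (simp add: less_imp_neq[symmetric])
qed

text \<open>The splitting is A (B' - B) + (A' - A) B'. Here \<open>B'\<close> has the same limit as
  \<open>B\<close>, because its quotients converge while \<open>t\<close> tends to 0.\<close>

lemma matrix_mult_quotient:
  fixes A A' :: "nat \<Rightarrow> real^'n^'m" and B B' :: "nat \<Rightarrow> real^'p^'n"
  assumes A: "A \<longlonglongrightarrow> A0" "(\<lambda>k. (A' k - A k) /\<^sub>R t k) \<longlonglongrightarrow> dA"
    and B: "B \<longlonglongrightarrow> B0" "(\<lambda>k. (B' k - B k) /\<^sub>R t k) \<longlonglongrightarrow> dB"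
    and t: "\<And>k. 0 < t k" "t \<longlonglongrightarrow> 0"
  shows "(\<lambda>k. (A' k ** B' k - A k ** B k) /\<^sub>R t k) \<longlonglongrightarrow> A0 ** dB + dA ** B0"
proof -
  interpret mm: bounded_bilinear "(**) :: real^'n^'m \<Rightarrow> real^'p^'n \<Rightarrow> real^'p^'m"
    by (rule bounded_bilinear_matrix_mult)
  have "(\<lambda>k. A k ** ((B' k - B k) /\<^sub>R t k) + ((A' k - A k) /\<^sub>R t k) ** B' k) \<longlonglongrightarrow> A0 ** dB + dA ** B0"
    by (intro tendsto_intros tendsto_matrix_mult A B tendsto_of_quotient[OF B t])
  then show ?thesis
    by (simp add: mm.scaleR_left mm.scaleR_right mm.diff_left mm.diff_right scaleR_right_diff_distrib algebra_simps)
qed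

text \<open>An entry -c / w changes by c (w' - w) / (w' w). Positivity of w and w' comes from their
  common positive limit, so the identity is used for large k.\<close>

lemma Amap_quotient:
  assumes W: "W \<longlonglongrightarrow> W0" "(\<lambda>k. (W' k - W k) /\<^sub>R t k) \<longlonglongrightarrow> v" and W0: "W0 \<in> Wset s"
    and t: "\<And>k. 0 < t k" "t \<longlonglongrightarrow> 0"
  shows "(\<lambda>k. (Amap s b (W' k) - Amap s b (W k)) /\<^sub>R t k) \<longlonglongrightarrow> dAmap s b W0 v"
proof (rule tendsto_matrixI)
  fix i j
  show "(\<lambda>k. ((Amap s b (W' k) - Amap s b (W k)) /\<^sub>R t k) $ i $ j) \<longlonglongrightarrow> dAmap s b W0 v $ i $ j"
  proof (cases "(j, i) \<in> I2 s")
    case True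
    let ?c = "(b (pos i div 2))\<^sup>2"
    have pos: "0 < W0 $ j $ i" using Wset_pos[OF W0 True] .
    have w: "(\<lambda>k. W k $ j $ i) \<longlonglongrightarrow> W0 $ j $ i" by (intro tendsto_intros W)
    have w': "(\<lambda>k. W' k $ j $ i) \<longlonglongrightarrow> W0 $ j $ i" by (intro tendsto_intros tendsto_of_quotient[OF W t])
    have q: "(\<lambda>k. ((W' k - W k) /\<^sub>R t k) $ j $ i) \<longlonglongrightarrow> v $ j $ i" by (intro tendsto_intros W)
    have "(\<lambda>k. ?c * ((W' k - W k) /\<^sub>R t k) $ j $ i / (W' k $ j $ i * W k $ j $ i)) \<longlonglongrightarrow>
        ?c * v $ j $ i / (W0 $ j $ i * W0 $ j $ i)"
      using pos by (intro tendsto_intros w w' q) auto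
    moreover have "\<forall>\<^sub>F k in sequentially. ?c * ((W' k - W k) /\<^sub>R t k) $ j $ i / (W' k $ j $ i * W k $ j $ i)
       = ((Amap s b (W' k) - Amap s b (W k)) /\<^sub>R t k) $ i $ j"
      using order_tendstoD(1)[OF w pos] order_tendstoD(1)[OF w' pos]
    proof eventually_elim
      case (elim k)
      then show ?case using True t(1)[of k] by (simp add: Amap_def field_simps)
    qed
    ultimately show ?thesis using True by (auto simp: dAmap_def power2_eq_square intro: Lim_transform_eventually)
  qed (simp add: Amap_def dAmap_def)
qed

text \<open>A strict form of differentiability: the increments shrink at the rate \<open>t\<close>,
  while nothing is known about the rate at which \<open>Z k\<close> approaches
  \<open>Z0\<close>.\<close>

lemma Fmap_quotient:
  assumes Z: "Z \<longlonglongrightarrow> Z0" "(\<lambda>k. (Z' k - Z k) /\<^sub>R t k) \<longlonglongrightarrow> v" and Z0: "Z0 \<in> Zman s"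
    and t: "\<And>k. 0 < t k" "t \<longlonglongrightarrow> 0"
  shows "(\<lambda>k. (Fmap s a b lam (Z' k) - Fmap s a b lam (Z k)) /\<^sub>R t k) \<longlonglongrightarrow> dFmap s a b lam Z0 v"
proof -
  have C: "(\<lambda>k. (fst (Z' k) - fst (Z k)) /\<^sub>R t k) \<longlonglongrightarrow> fst v"
    using tendsto_fst[OF Z(2)] by simp
  have Q: "(\<lambda>k. (fst (snd (Z' k)) - fst (snd (Z k))) /\<^sub>R t k) \<longlonglongrightarrow> fst (snd v)"
    using tendsto_fst[OF tendsto_snd[OF Z(2)]] by simp
  have W: "(\<lambda>k. (fst (snd (snd (Z' k))) - fst (snd (snd (Z k)))) /\<^sub>R t k) \<longlonglongrightarrow> fst (snd (snd v))"
    using tendsto_fst[OF tendsto_snd[OF tendsto_snd[OF Z(2)]]] by simp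
  have V: "(\<lambda>k. (snd (snd (snd (Z' k))) - snd (snd (snd (Z k)))) /\<^sub>R t k) \<longlonglongrightarrow> snd (snd (snd v))"
    using tendsto_snd[OF tendsto_snd[OF tendsto_snd[OF Z(2)]]] by simp
  have limQ: "(\<lambda>k. fst (snd (Z k))) \<longlonglongrightarrow> fst (snd Z0)" by (intro tendsto_intros Z)
  have limW: "(\<lambda>k. fst (snd (snd (Z k)))) \<longlonglongrightarrow> fst (snd (snd Z0))" by (intro tendsto_intros Z)
  have "(\<lambda>k. (Amap s b (fst (snd (snd (Z' k)))) - Amap s b (fst (snd (snd (Z k))))) /\<^sub>R t k
      + (fst (snd (snd (Z' k))) - fst (snd (snd (Z k)))) /\<^sub>R t k
      + (snd (snd (snd (Z' k))) - snd (snd (snd (Z k)))) /\<^sub>R t k) \<longlonglongrightarrow> dschur_factor s b Z0 v"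
    unfolding dschur_factor_def by (intro tendsto_intros W V Amap_quotient[OF limW W Zman_W[OF Z0] t])
  then have core: "(\<lambda>k. (schur_factor s a b lam (Z' k) - schur_factor s a b lam (Z k)) /\<^sub>R t k) \<longlonglongrightarrow> dschur_factor s b Z0 v"
    unfolding schur_factor_def scaleR_add_right[symmetric] by (simp add: algebra_simps)
  have QT: "(\<lambda>k. (transpose (fst (snd (Z' k))) - transpose (fst (snd (Z k)))) /\<^sub>R t k) \<longlonglongrightarrow> transpose (fst (snd v))"
    using tendsto_transpose[OF Q] by (simp add: transpose_scalar transpose_minus)
  note QM = matrix_mult_quotient[OF limQ Q tendsto_schur_factor[OF Z(1) Z0] core t]
  note limQM = tendsto_matrix_mult[OF limQ tendsto_schur_factor[OF Z(1) Z0, of a b lam]]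
  note QMQ = matrix_mult_quotient[OF limQM QM tendsto_transpose[OF limQ] QT t]
  from tendsto_diff[OF C QMQ] show ?thesis
    unfolding Fmap_eq dFmap_def scaleR_diff_right[symmetric] by (simp add: algebra_simps)
qed

section \<open>Riemannian metric and adjoints\<close>

text \<open>Riesz representation for the inner product pulled back along \<open>D\<close>. A left
  inverse \<open>E\<close> of \<open>D\<close> on \<open>T\<close> extends the functional to the
  ambient space, where \<open>w\<close> represents it; projecting \<open>w\<close> orthogonally onto
  the image of \<open>T\<close> gives the image of the representer.\<close>

lemma riesz_pullback:
  fixes D :: "'a::euclidean_space \<Rightarrow> 'b::euclidean_space" and L :: "'a \<Rightarrow> real"
  assumes D: "linear D" and T: "subspace T" and inj: "inj_on D T" and L: "linear L"
  shows "\<exists>!\<zeta>. \<zeta> \<in> T \<and> (\<forall>\<xi>\<in>T. D \<xi> \<bullet> D \<zeta> = L \<xi>)"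
proof (rule ex_ex1I)
  obtain E where E: "linear E" "\<And>v. v \<in> T \<Longrightarrow> E (D v) = v"
    using linear_exists_left_inverse_on[OF D T inj] by blast
  have LE: "linear (\<lambda>x. L (E x))" using linear_compose[OF E(1) L] by (simp add: o_def)
  define w where "w = (\<Sum>b\<in>Basis. L (E b) *\<^sub>R b)"
  have w: "x \<bullet> w = L (E x)" for x
  proof -
    have "L (E x) = L (E (\<Sum>b\<in>Basis. (x \<bullet> b) *\<^sub>R b))" by (simp add: euclidean_representation)
    also have "\<dots> = (\<Sum>b\<in>Basis. (x \<bullet> b) * L (E b))"
      by (simp add: linear_sum[OF LE] linear_cmul[OF LE])
    finally show ?thesis by (simp add: w_def inner_sum_right mult.commute)
  qed
  have "subspace (D ` T)" by (rule linear_subspace_image[OF D T])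
  then have span: "span (D ` T) = D ` T" by (simp add: span_eq_iff)
  obtain y z where y: "y \<in> D ` T" and z: "\<And>v. v \<in> D ` T \<Longrightarrow> orthogonal z v" and wyz: "w = y + z"
    using orthogonal_subspace_decomp_exists[of "D ` T" w] unfolding span by blast
  obtain \<zeta> where \<zeta>: "\<zeta> \<in> T" "y = D \<zeta>" using y by blast
  have "D \<xi> \<bullet> D \<zeta> = L \<xi>" if "\<xi> \<in> T" for \<xi>
  proof -
    have "D \<xi> \<bullet> w = D \<xi> \<bullet> D \<zeta>"
      using z[of "D \<xi>"] that by (simp add: wyz \<zeta>(2) inner_add_right orthogonal_def inner_commute)
    then show ?thesis using w[of "D \<xi>"] E(2)[OF that] by simp
  qed
  then show "\<exists>\<zeta>. \<zeta> \<in> T \<and> (\<forall>\<xi>\<in>T. D \<xi> \<bullet> D \<zeta> = L \<xi>)" using \<zeta>(1) by blast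
next
  fix \<zeta> \<zeta>'
  assume a: "\<zeta> \<in> T \<and> (\<forall>\<xi>\<in>T. D \<xi> \<bullet> D \<zeta> = L \<xi>)" "\<zeta>' \<in> T \<and> (\<forall>\<xi>\<in>T. D \<xi> \<bullet> D \<zeta>' = L \<xi>)"
  then have "\<zeta> - \<zeta>' \<in> T" using T by (simp add: subspace_diff)
  then have "D (\<zeta> - \<zeta>') \<bullet> D (\<zeta> - \<zeta>') = 0"
    using a by (metis linear_diff[OF D] inner_diff_right diff_self)
  then have "D \<zeta> = D \<zeta>'" by (simp add: linear_diff[OF D])
  then show "\<zeta> = \<zeta>'" using inj a by (simp add: inj_on_eq_iff)
qed

lemma metric_eq:
  "metric s Z \<xi> \<eta> =
     (\<Sum>i\<in>UNIV. \<Sum>j\<in>UNIV. fst \<xi> $ i $ j * fst \<eta> $ i $ j / fst Z $ i $ j) + fst (snd \<xi>) \<bullet> fst (snd \<eta>)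
     + (\<Sum>i\<in>UNIV. \<Sum>j\<in>UNIV. if (i, j) \<in> I2 s
          then fst (snd (snd \<xi>)) $ i $ j * fst (snd (snd \<eta>)) $ i $ j / fst (snd (snd Z)) $ i $ j else 0)
     + snd (snd (snd \<xi>)) \<bullet> snd (snd (snd \<eta>))"
proof -
  have "(\<Sum>(i, j)\<in>I2 s. f i j) = (\<Sum>i\<in>UNIV. \<Sum>j\<in>UNIV. if (i, j) \<in> I2 s then f i j else 0)"
    for f :: "'a \<Rightarrow> 'a \<Rightarrow> real"
    unfolding sum.cartesian_product by (rule sum.mono_neutral_cong_left) auto
  moreover obtain C Q W V where "Z = (C, Q, W, V)" by (cases Z) auto
  moreover obtain x1 x2 x3 x4 where "\<xi> = (x1, x2, x3, x4)" by (cases \<xi>) auto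
  moreover obtain y1 y2 y3 y4 where "\<eta> = (y1, y2, y3, y4)" by (cases \<eta>) auto
  ultimately show ?thesis
    by (simp add: metric_def metric_DP_def metric_W_def cong: if_cong)
qed

lemma metric_commute: "metric s Z \<xi> \<eta> = metric s Z \<eta> \<xi>"
  unfolding metric_eq by (simp add: mult.commute inner_commute cong: if_cong)

text \<open>Dividing by square roots of the weights turns the Riemannian metric into the Euclidean
  inner product, so that adjoints and gradients fall under \<open>riesz_pullback\<close>.\<close>

definition metric_scale :: "nat \<Rightarrow> 'n::{finite,linorder} point \<Rightarrow> 'n point \<Rightarrow> 'n point" where
  "metric_scale s Z \<xi> = (\<chi> i j. fst \<xi> $ i $ j / sqrt (fst Z $ i $ j), fst (snd \<xi>),
     \<chi> i j. if (i, j) \<in> I2 s then fst (snd (snd \<xi>)) $ i $ j / sqrt (fst (snd (snd Z)) $ i $ j) else 0,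
     snd (snd (snd \<xi>)))"

lemma linear_metric_scale: "linear (metric_scale s Z)"
  by (rule linearI) (auto simp: metric_scale_def vec_eq_iff add_divide_distrib)

lemma Zman_C_pos: "Z \<in> Zman s \<Longrightarrow> 0 < fst Z $ i $ j"
  by (auto simp: Zman_def DP_iff)

lemma metric_eq_inner_scale:
  assumes "Z \<in> Zman s"
  shows "metric s Z \<xi> \<eta> = metric_scale s Z \<xi> \<bullet> metric_scale s Z \<eta>"
proof -
  note posW = Wset_pos[OF Zman_W[OF assms]]
  have W: "(if (i, j) \<in> I2 s then fst (snd (snd \<xi>)) $ i $ j * fst (snd (snd \<eta>)) $ i $ j / fst (snd (snd Z)) $ i $ j else 0)
    = fst (snd (snd (metric_scale s Z \<xi>))) $ i $ j * fst (snd (snd (metric_scale s Z \<eta>))) $ i $ j" for i j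
    using posW[of i j] by (auto simp: metric_scale_def)
  have C: "fst \<xi> $ i $ j * fst \<eta> $ i $ j / fst Z $ i $ j
    = fst (metric_scale s Z \<xi>) $ i $ j * fst (metric_scale s Z \<eta>) $ i $ j" for i j
    using Zman_C_pos[OF assms, of i j] by (simp add: metric_scale_def)
  have QV: "fst (snd (metric_scale s Z \<xi>)) = fst (snd \<xi>)" "snd (snd (snd (metric_scale s Z \<xi>))) = snd (snd (snd \<xi>))" for \<xi>
    by (simp_all add: metric_scale_def)
  show ?thesis unfolding metric_eq W C
    by (simp only: inner_prod_def inner_vec_def inner_real_def QV add.assoc)
qed

lemma metric_nonneg: "Z \<in> Zman s \<Longrightarrow> 0 \<le> metric s Z \<xi> \<xi>"
  by (simp add: metric_eq_inner_scale)

text \<open>The metric divides by entries of \<open>C\<close> and \<open>W\<close>, so upper bounds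
  on these entries control the Euclidean norm, and one \<open>\<omega>\<close> serves along a whole
  bounded sequence. Entries of the third component outside \<open>I2 s\<close>, invisible to the
  metric, vanish by tangency.\<close>

lemma norm_le_metric:
  assumes Z: "Z \<in> Zman s" "norm Z \<le> \<omega>" "1 \<le> \<omega>" and \<xi>: "\<xi> \<in> tangent s Z"
  shows "(norm \<xi>)\<^sup>2 \<le> \<omega> * metric s Z \<xi> \<xi>"
proof -
  obtain C Q W V where Zeq: "Z = (C, Q, W, V)" by (cases Z) auto
  obtain x1 x2 x3 x4 where \<xi>eq: "\<xi> = (x1, x2, x3, x4)" by (cases \<xi>) auto
  have "norm C \<le> \<omega>" "norm W \<le> \<omega>"
    using Z(2) norm_fst_le[of C "(Q, W, V)"] norm_snd_le[of "(Q, W, V)" C] norm_snd_le[of "(W, V)" Q] norm_fst_le[of W V]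
    unfolding Zeq by linarith+
  then have le: "C $ i $ j \<le> \<omega>" "W $ i $ j \<le> \<omega>" for i j
    using entry_le_norm[of C i j] entry_le_norm[of W i j] by linarith+
  have scal: "x\<^sup>2 \<le> \<omega> * (x * x / c)" if "0 < c" "c \<le> \<omega>" for x c
  proof -
    have "x\<^sup>2 * c \<le> x\<^sup>2 * \<omega>" using that by (intro mult_left_mono) auto
    then show ?thesis using that by (simp add: field_simps power2_eq_square)
  qed
  have posC: "0 < C $ i $ j" for i j using Zman_C_pos[OF Z(1)] by (simp add: Zeq)
  have posW: "0 < W $ i $ j" if "(i, j) \<in> I2 s" for i j using Wset_pos[OF Zman_W[OF Z(1)] that] by (simp add: Zeq)
  have x3: "x3 $ i $ j = 0" if "(i, j) \<notin> I2 s" for i j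
    using \<xi> that by (simp add: Zeq \<xi>eq tangent_def tangent_W_def)
  have "(norm \<xi>)\<^sup>2 = (norm x1)\<^sup>2 + (norm x2)\<^sup>2 + (norm x3)\<^sup>2 + (norm x4)\<^sup>2"
    by (simp add: \<xi>eq norm_Pair)
  moreover have "(norm x1)\<^sup>2 \<le> \<omega> * (\<Sum>i\<in>UNIV. \<Sum>j\<in>UNIV. x1 $ i $ j * x1 $ i $ j / C $ i $ j)"
    unfolding norm_matrix_power2 sum_distrib_left by (intro sum_mono scal posC le)
  moreover have "(norm x3)\<^sup>2 \<le> \<omega> * (\<Sum>i\<in>UNIV. \<Sum>j\<in>UNIV. if (i, j) \<in> I2 s then x3 $ i $ j * x3 $ i $ j / W $ i $ j else 0)"
  proof -
    have "(x3 $ i $ j)\<^sup>2 \<le> \<omega> * (if (i, j) \<in> I2 s then x3 $ i $ j * x3 $ i $ j / W $ i $ j else 0)" for i j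
      using scal[OF posW le(2)] x3 by simp
    then show ?thesis unfolding norm_matrix_power2 sum_distrib_left by (intro sum_mono)
  qed
  moreover have "(norm x2)\<^sup>2 \<le> \<omega> * (x2 \<bullet> x2)"
    using mult_right_mono[OF Z(3), of "x2 \<bullet> x2"] by (simp add: power2_norm_eq_inner)
  moreover have "(norm x4)\<^sup>2 \<le> \<omega> * (x4 \<bullet> x4)"
    using mult_right_mono[OF Z(3), of "x4 \<bullet> x4"] by (simp add: power2_norm_eq_inner)
  ultimately show ?thesis unfolding metric_eq Zeq \<xi>eq fst_conv snd_conv distrib_left by linarith
qed

lemma Vset_iff: "V \<in> Vset s \<longleftrightarrow> (\<forall>i j. (i, j) \<in> I1 \<union> I2 s \<longrightarrow> V $ i $ j = 0)"
  by (auto simp: Vset_def)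

lemma subspace_tangent: "subspace (tangent s Z)"
proof -
  obtain C Q W V where Zeq: "Z = (C, Q, W, V)" by (cases Z) auto
  have 1: "subspace tangent_DP"
    by (rule subspaceI) (auto simp: tangent_DP_iff sum.distrib sum_distrib_left[symmetric])
  have "transpose Q ** (\<xi> + \<eta>) + transpose (\<xi> + \<eta>) ** Q =
      (transpose Q ** \<xi> + transpose \<xi> ** Q) + (transpose Q ** \<eta> + transpose \<eta> ** Q)" for \<xi> \<eta>
    by (simp add: transpose_add matrix_add_ldistrib matrix_add_rdistrib)
  moreover have "transpose Q ** (c *\<^sub>R \<xi>) + transpose (c *\<^sub>R \<xi>) ** Q = c *\<^sub>R (transpose Q ** \<xi> + transpose \<xi> ** Q)" for c \<xi>
    by (simp add: vec_eq_iff matrix_matrix_mult_def transpose_def sum_distrib_left algebra_simps)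
  moreover have "transpose Q ** 0 + transpose 0 ** Q = 0"
    by (simp add: vec_eq_iff matrix_matrix_mult_def transpose_def)
  ultimately have 2: "subspace (tangent_Orth Q)"
    by (intro subspaceI) (simp_all add: tangent_Orth_def)
  have 3: "subspace (tangent_W s :: 'a matrix set)" by (rule subspaceI) (auto simp: tangent_W_def)
  have 4: "subspace (Vset s :: 'a matrix set)" by (rule subspaceI) (auto simp: Vset_iff)
  show ?thesis unfolding Zeq tangent_def by (simp add: subspace_Times 1 2 3 4)
qed

text \<open>Gives meaning to the definite descriptions \<open>DF_adjoint\<close> and
  \<open>riem_grad\<close> at points of the manifold.\<close>

lemma metric_riesz:
  assumes Z: "Z \<in> Zman s" and L: "linear L"
  shows "\<exists>!\<zeta>. \<zeta> \<in> tangent s Z \<and> (\<forall>\<xi>\<in>tangent s Z. metric s Z \<xi> \<zeta> = L \<xi>)"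
  unfolding metric_eq_inner_scale[OF Z]
proof (rule riesz_pullback[OF linear_metric_scale subspace_tangent _ L])
  show "inj_on (metric_scale s Z) (tangent s Z)"
  proof (rule inj_onI)
    fix x y assume xy: "x \<in> tangent s Z" "y \<in> tangent s Z" "metric_scale s Z x = metric_scale s Z y"
    then have "x - y \<in> tangent s Z" by (simp add: subspace_diff[OF subspace_tangent])
    from norm_le_metric[OF Z _ _ this, of "max 1 (norm Z)"]
    have "(norm (x - y))\<^sup>2 \<le> max 1 (norm Z) * metric s Z (x - y) (x - y)" by simp
    also have "metric s Z (x - y) (x - y) = 0"
      using xy(3) by (simp add: metric_eq_inner_scale[OF Z] linear_diff[OF linear_metric_scale])
    finally show "x = y" by simp
  qed
qed

lemma linear_dFmap_inner:
  assumes "Z \<in> Zman s"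
  shows "linear (\<lambda>\<xi>. dFmap s a b lam Z \<xi> \<bullet> Y)"
  using linear_dFmap[OF assms, of a b lam] by (simp add: linear_iff inner_add_left)

lemma DF_adjoint_props:
  assumes Z: "Z \<in> Zman s"
  shows "DF_adjoint s a b lam Z Y \<in> tangent s Z"
    and "\<xi> \<in> tangent s Z \<Longrightarrow> metric s Z \<xi> (DF_adjoint s a b lam Z Y) = dFmap s a b lam Z \<xi> \<bullet> Y"
  using theI'[OF metric_riesz[OF Z linear_dFmap_inner[OF Z, of a b lam Y]]]
  unfolding DF_adjoint_def DF_eq[OF Z] by blast+

lemma riem_grad_eq:
  assumes Z: "Z \<in> Zman s"
  shows "riem_grad s (objective s a b lam) Z = DF_adjoint s a b lam Z (Fmap s a b lam Z)"
  unfolding riem_grad_def DF_adjoint_def DF_eq[OF Z] frechet_derivative_objective[OF Z]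
  by (simp add: metric_commute[of s Z _ _])

lemma DF_adjoint_eq_0:
  assumes Z: "Z \<in> Zman s" and 0: "\<And>\<xi>. \<xi> \<in> tangent s Z \<Longrightarrow> dFmap s a b lam Z \<xi> \<bullet> Y = 0"
  shows "DF_adjoint s a b lam Z Y = 0"
proof -
  have "metric s Z \<xi> 0 = 0" for \<xi>
    by (simp add: metric_eq_inner_scale[OF Z] linear_0[OF linear_metric_scale])
  then have "0 \<in> tangent s Z \<and> (\<forall>\<xi>\<in>tangent s Z. metric s Z \<xi> 0 = dFmap s a b lam Z \<xi> \<bullet> Y)"
    by (simp add: 0 subspace_0[OF subspace_tangent])
  moreover have "DF_adjoint s a b lam Z Y \<in> tangent s Z \<and>
      (\<forall>\<xi>\<in>tangent s Z. metric s Z \<xi> (DF_adjoint s a b lam Z Y) = dFmap s a b lam Z \<xi> \<bullet> Y)"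
    using DF_adjoint_props[OF Z] by blast
  ultimately show ?thesis using metric_riesz[OF Z linear_dFmap_inner[OF Z]] by blast
qed

lemma tendsto_metric:
  assumes Z: "Z \<longlonglongrightarrow> Z0" "Z0 \<in> Zman s" and "\<xi> \<longlonglongrightarrow> \<xi>0" "\<eta> \<longlonglongrightarrow> \<eta>0"
  shows "(\<lambda>k. metric s (Z k) (\<xi> k) (\<eta> k)) \<longlonglongrightarrow> metric s Z0 \<xi>0 \<eta>0"
proof -
  have "(\<lambda>k. if (i, j) \<in> I2 s then fst (snd (snd (\<xi> k))) $ i $ j * fst (snd (snd (\<eta> k))) $ i $ j
            / fst (snd (snd (Z k))) $ i $ j else 0)
     \<longlonglongrightarrow> (if (i, j) \<in> I2 s then fst (snd (snd \<xi>0)) $ i $ j * fst (snd (snd \<eta>0)) $ i $ j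
            / fst (snd (snd Z0)) $ i $ j else 0)" for i j
    using Wset_pos[OF Zman_W[OF Z(2)], of i j] by (auto intro!: tendsto_intros assms)
  moreover have "fst Z0 $ i $ j \<noteq> 0" for i j using Zman_C_pos[OF Z(2), of i j] by simp
  ultimately show ?thesis unfolding metric_eq by (intro tendsto_intros assms)
qed

text \<open>Only the tangent spaces of the orthogonal group move; left translation transports them.\<close>

lemma tangent_approx:
  assumes Z: "\<And>k. Z k \<in> Zman s" "Z \<longlonglongrightarrow> Z0" and Z0: "Z0 \<in> Zman s" and \<xi>: "\<xi> \<in> tangent s Z0"
  obtains \<xi>' where "\<And>k. \<xi>' k \<in> tangent s (Z k)" "\<xi>' \<longlonglongrightarrow> \<xi>"
proof
  define Q where "Q = (\<lambda>k. fst (snd (Z k)))"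
  define Q0 where "Q0 = fst (snd Z0)"
  define \<xi>' where "\<xi>' = (\<lambda>k. (fst \<xi>, Q k ** (transpose Q0 ** fst (snd \<xi>)), snd (snd \<xi>)))"
  have tan0: "fst \<xi> \<in> tangent_DP" "fst (snd \<xi>) \<in> tangent_Orth Q0"
    "fst (snd (snd \<xi>)) \<in> tangent_W s" "snd (snd (snd \<xi>)) \<in> Vset s"
    using \<xi> by (auto simp: tangent_def Q0_def split: prod.splits)
  have orth: "orthogonal_matrix (Q k)" "orthogonal_matrix Q0" for k
    using Z(1)[of k] Z0 by (auto simp: Zman_def Orth_def Q_def Q0_def)
  show "\<xi>' k \<in> tangent s (Z k)" for k
  proof -
    have 1: "transpose (Q k) ** (Q k ** M) = M" for M
      using orth(1)[of k] by (simp add: matrix_mul_assoc orthogonal_matrix)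
    have 2: "transpose (Q k ** M) ** Q k = transpose M" for M
      using orth(1)[of k] by (simp add: matrix_transpose_mul matrix_mul_assoc[symmetric] orthogonal_matrix)
    have "Q k ** (transpose Q0 ** fst (snd \<xi>)) \<in> tangent_Orth (Q k)"
      using tan0(2) unfolding tangent_Orth_def mem_Collect_eq 1 2 by (simp add: matrix_transpose_mul)
    moreover have "tangent s (Z k) = tangent_DP \<times> tangent_Orth (Q k) \<times> tangent_W s \<times> Vset s"
      by (cases "Z k") (simp add: tangent_def Q_def)
    ultimately show ?thesis using tan0 by (simp add: \<xi>'_def mem_Times_iff)
  qed
  have "Q \<longlonglongrightarrow> Q0" unfolding Q_def Q0_def by (intro tendsto_intros Z)
  then have "(\<lambda>k. Q k ** (transpose Q0 ** fst (snd \<xi>))) \<longlonglongrightarrow> Q0 ** (transpose Q0 ** fst (snd \<xi>))"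
    by (intro tendsto_matrix_mult tendsto_const)
  moreover have "Q0 ** (transpose Q0 ** fst (snd \<xi>)) = fst (snd \<xi>)"
    using orth(2) by (simp add: matrix_mul_assoc orthogonal_matrix_def)
  ultimately have "(\<lambda>k. Q k ** (transpose Q0 ** fst (snd \<xi>))) \<longlonglongrightarrow> fst (snd \<xi>)" by simp
  then have "\<xi>' \<longlonglongrightarrow> (fst \<xi>, fst (snd \<xi>), snd (snd \<xi>))"
    unfolding \<xi>'_def by (intro tendsto_Pair tendsto_const)
  then show "\<xi>' \<longlonglongrightarrow> \<xi>" by simp
qed

section \<open>Accumulation points\<close>

text \<open>Discrete Gronwall: 1 + \<gamma> \<le> exp \<gamma> bounds \<open>u\<close> uniformly,
  after which the terms \<gamma> u are summable and telescoping bounds the partial sums of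
  \<open>e\<close>. It is applied to the squared residual, which need not be monotone.\<close>

lemma summable_perturbed_descent:
  fixes u e \<gamma> :: "nat \<Rightarrow> real"
  assumes nonneg: "\<And>k. 0 \<le> u k" "\<And>k. 0 \<le> e k" "\<And>k. 0 \<le> \<gamma> k"
    and "summable \<gamma>" and step: "\<And>k. u (Suc k) \<le> (1 + \<gamma> k) * u k - e k"
  shows "summable e"
proof -
  define G where "G = suminf \<gamma>"
  have G: "sum \<gamma> {..<n} \<le> G" for n
    unfolding G_def by (intro sum_le_suminf assms) auto
  have "u n \<le> u 0 * exp (sum \<gamma> {..<n})" for n
  proof (induction n)
    case (Suc n)
    have "u (Suc n) \<le> (1 + \<gamma> n) * u n" using step[of n] nonneg(2)[of n] by linarith
    also have "\<dots> \<le> exp (\<gamma> n) * (u 0 * exp (sum \<gamma> {..<n}))"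
      using Suc nonneg by (intro mult_mono exp_ge_add_one_self) auto
    finally show ?case by (simp add: exp_add mult_ac)
  qed simp
  moreover have "u 0 * exp (sum \<gamma> {..<n}) \<le> u 0 * exp G" for n
    using G nonneg by (intro mult_left_mono) auto
  ultimately have bound: "u n \<le> u 0 * exp G" for n using order_trans by blast
  have "sum e {..<n} \<le> u 0 - u n + u 0 * exp G * sum \<gamma> {..<n}" for n
  proof (induction n)
    case (Suc n)
    have "\<gamma> n * u n \<le> \<gamma> n * (u 0 * exp G)" using bound nonneg by (intro mult_left_mono) auto
    then show ?case using Suc step[of n] by (simp add: algebra_simps)
  qed simp
  moreover have "u 0 * exp G * sum \<gamma> {..<n} \<le> u 0 * exp G * G" for n
    using G nonneg by (intro mult_left_mono) auto
  ultimately have "sum e {..<n} \<le> u 0 + u 0 * exp G * G" for n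
    using nonneg(1)[of n] by (smt (verit))
  then show ?thesis using summableI_nonneg_bounded[of e] nonneg(2) by blast
qed

theorem theorem3p2:
  fixes s :: nat and a b :: "nat \<Rightarrow> real" and lam :: "nat \<Rightarrow> complex"
    and \<tau> \<rho> \<sigma>max \<delta> :: real and \<eta> \<gamma> :: "nat \<Rightarrow> real"
    and Z :: "nat \<Rightarrow> 'n::{finite,linorder} point" and Zstar :: "'n point"
  assumes "spectral_data CARD('n) s a b lam"
    and "\<exists>A \<in> (DP :: 'n matrix set). has_eigenvalue_list A lam"
    and "0 < \<tau>" "\<tau> < 1" and "0 < \<rho>" "\<rho> < 1" and "0 < \<sigma>max" "\<sigma>max < 1"
    and "0 < \<delta>" "\<delta> < 1 / 2"
    and "\<And>k. 0 < \<eta> k" and "\<eta> \<longlonglongrightarrow> 0"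
    and "\<And>k. 0 < \<gamma> k" and "summable \<gamma>"
    and "newton_cg_sequence s a b lam \<tau> \<rho> \<sigma>max \<delta> \<eta> \<gamma> Z"
    and "Zstar \<in> Zman s"
    and "\<exists>r. strict_mono r \<and> (Z \<circ> r) \<longlonglongrightarrow> Zstar"
  shows "riem_grad s (objective s a b lam) Zstar = 0"
proof -

  \<comment> \<open>Directions and step lengths chosen by the run\<close>
  note \<tau> = assms(3,4) and \<rho> = assms(5,6) and \<sigma>max = assms(7,8) and \<delta> = assms(9)
    and \<eta> = assms(11,12) and \<gamma> = assms(13,14) and Zstar = assms(16)
  define F :: "'n point \<Rightarrow> 'n matrix" where "F = Fmap s a b lam"
  define J :: "'n point \<Rightarrow> 'n point \<Rightarrow> 'n matrix" where "J = dFmap s a b lam"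
  define g :: "'n point \<Rightarrow> 'n point \<Rightarrow> 'n point \<Rightarrow> real" where "g = metric s"
  have Zman: "Z k \<in> Zman s" and Fnz: "F (Z k) \<noteq> 0" for k
    using assms(15) unfolding newton_cg_sequence_def F_def by auto
  define \<sigma> where "\<sigma> = (\<lambda>k. min \<sigma>max (norm (F (Z k))))"
  have \<sigma>pos: "0 < \<sigma> k" for k using Fnz[of k] \<sigma>max by (simp add: \<sigma>_def)
  define d where "d = (\<lambda>k v. g (Z k) (riem_grad s (objective s a b lam) (Z k)) v)"
  define full where "full = (\<lambda>k v. norm (F (retract s (Z k) v)) \<le> \<tau> * norm (F (Z k)))"
  define LS where "LS = (\<lambda>k v t. (norm (F (retract s (Z k) (t *\<^sub>R v))))\<^sup>2 - (norm (F (Z k)))\<^sup>2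
      \<le> - \<delta> * t\<^sup>2 * \<bar>d k v\<bar> + \<gamma> k * (norm (F (Z k)))\<^sup>2)"
  let ?P = "\<lambda>k y v t.
       norm (J (Z k) (DF_adjoint s a b lam (Z k) y) + \<sigma> k *\<^sub>R y + F (Z k)) 
         \<le> min (\<eta> k) (norm (F (Z k))) * norm (F (Z k)) \<and>
       v = DF_adjoint s a b lam (Z k) y \<and>
       (if full k v then t = 1
        else t \<in> {\<rho> ^ l | l. LS k v (\<rho> ^ l)} \<and> (\<forall>\<beta>\<in>{\<rho> ^ l | l. LS k v (\<rho> ^ l)}. \<beta> \<le> t)) \<and>
       Z (Suc k) = retract s (Z k) (t *\<^sub>R v)"
  have "\<forall>k. \<exists>y v t. ?P k y v t"
  proof
    fix k
    have "newton_cg_step s a b lam \<tau> \<rho> \<sigma>max \<delta> (\<eta> k) (\<gamma> k) (Z k) (Z (Suc k))"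
      using assms(15) unfolding newton_cg_sequence_def by blast
    then show "\<exists>y v t. ?P k y v t"
      unfolding newton_cg_step_def Let_def DF_eq[OF Zman] F_def[symmetric] J_def[symmetric] \<sigma>_def
        full_def LS_def d_def g_def .
  qed
  then obtain dY dZ \<alpha> where all: "\<forall>k. ?P k (dY k) (dZ k) (\<alpha> k)"
    unfolding choice_iff by (elim exE)
  have dZ: "dZ k = DF_adjoint s a b lam (Z k) (dY k)" for k using all by blast
  have res: "norm (J (Z k) (dZ k) + \<sigma> k *\<^sub>R dY k + F (Z k)) \<le> min (\<eta> k) (norm (F (Z k))) * norm (F (Z k))" for k
    unfolding dZ using all by blast
  have step: "if full k (dZ k) then \<alpha> k = 1
        else \<alpha> k \<in> {\<rho> ^ l | l. LS k (dZ k) (\<rho> ^ l)} \<and> (\<forall>\<beta>\<in>{\<rho> ^ l | l. LS k (dZ k) (\<rho> ^ l)}. \<beta> \<le> \<alpha> k)" for k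
    using spec[OF all, of k] by (elim conjE)
  have next_Z: "Z (Suc k) = retract s (Z k) (\<alpha> k *\<^sub>R dZ k)" for k using all by blast
  have dZ_tan: "dZ k \<in> tangent s (Z k)" for k unfolding dZ by (rule DF_adjoint_props(1)[OF Zman])
  have g_dZ: "g (Z k) \<xi> (dZ k) = J (Z k) \<xi> \<bullet> dY k" if "\<xi> \<in> tangent s (Z k)" for \<xi> k
    unfolding dZ g_def J_def by (rule DF_adjoint_props(2)[OF Zman that])
  have d: "d k (dZ k) = J (Z k) (dZ k) \<bullet> F (Z k)" for k
    unfolding d_def g_def J_def F_def riem_grad_eq[OF Zman] metric_commute[of s _ _ "dZ k"]
    by (rule DF_adjoint_props(2)[OF Zman dZ_tan])
  have full: "\<alpha> k = 1" if "full k (dZ k)" for k using step[of k] that by simp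
  have not_full: "\<exists>l. \<alpha> k = \<rho> ^ l \<and> LS k (dZ k) (\<rho> ^ l) \<and> (\<forall>l'. LS k (dZ k) (\<rho> ^ l') \<longrightarrow> \<rho> ^ l' \<le> \<rho> ^ l)"
    if "\<not> full k (dZ k)" for k
  proof -
    have "\<alpha> k \<in> {\<rho> ^ l | l. LS k (dZ k) (\<rho> ^ l)} \<and> (\<forall>\<beta>\<in>{\<rho> ^ l | l. LS k (dZ k) (\<rho> ^ l)}. \<beta> \<le> \<alpha> k)"
      using step[of k] that by simp
    then obtain l where "\<alpha> k = \<rho> ^ l" "LS k (dZ k) (\<rho> ^ l)"
      and max: "\<forall>\<beta>\<in>{\<rho> ^ l | l. LS k (dZ k) (\<rho> ^ l)}. \<beta> \<le> \<alpha> k" by blast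
    moreover have "\<rho> ^ l' \<le> \<rho> ^ l" if "LS k (dZ k) (\<rho> ^ l')" for l'
      using bspec[OF max, of "\<rho> ^ l'"] that \<open>\<alpha> k = \<rho> ^ l\<close> by auto
    ultimately show ?thesis by blast
  qed
  have \<alpha>pos: "0 < \<alpha> k" for k using full[of k] not_full[of k] \<rho> by (cases "full k (dZ k)") auto

  \<comment> \<open>Summable decrease of the squared residual\<close>
  define e where "e = (\<lambda>k. if full k (dZ k) then (1 - \<tau>\<^sup>2) * (norm (F (Z k)))\<^sup>2 else \<delta> * (\<alpha> k)\<^sup>2 * \<bar>d k (dZ k)\<bar>)"
  have \<tau>2: "\<tau>\<^sup>2 < 1" using \<tau> by (simp add: power_less_one_iff)
  have "summable e"
  proof (rule summable_perturbed_descent[where u = "\<lambda>k. (norm (F (Z k)))\<^sup>2"])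
    show "0 \<le> e k" for k using \<tau>2 \<delta> by (simp add: e_def)
    show "0 \<le> \<gamma> k" for k using \<gamma>(1)[of k] by simp
    \<comment> \<open>\<open>e\<close> is the decrease guaranteed by whichever test was passed: the
      \<open>\<tau>\<close> test leaves at most a fraction \<open>\<tau>\<^sup>2\<close> of the
      squared residual, the line search its own bound up to the \<open>\<gamma>\<close>
      term.\<close>
    show "(norm (F (Z (Suc k))))\<^sup>2 \<le> (1 + \<gamma> k) * (norm (F (Z k)))\<^sup>2 - e k" for k
    proof (cases "full k (dZ k)")
      case True
      then have "norm (F (Z (Suc k))) \<le> \<tau> * norm (F (Z k))"
        using full[OF True] by (simp add: full_def next_Z)
      then have "(norm (F (Z (Suc k))))\<^sup>2 \<le> (\<tau> * norm (F (Z k)))\<^sup>2" by (intro power_mono) auto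
      moreover have "0 \<le> \<gamma> k * (norm (F (Z k)))\<^sup>2" using \<gamma>(1)[of k] by simp
      ultimately show ?thesis using True by (simp add: e_def power_mult_distrib algebra_simps)
    next
      case False
      then have "LS k (dZ k) (\<alpha> k)" using not_full by metis
      then show ?thesis using False unfolding LS_def next_Z e_def by (simp add: algebra_simps)
    qed
  qed (use \<gamma> in auto)
  then have e0: "e \<longlonglongrightarrow> 0" by (rule summable_LIMSEQ_zero)

  show ?thesis
  proof (cases "F Zstar = 0")
    case True
    then show ?thesis unfolding riem_grad_eq[OF Zstar]
      by (intro DF_adjoint_eq_0[OF Zstar]) (simp add: F_def)
  next
    case Fstar: False

    \<comment> \<open>Bounded Newton directions along a subsequence\<close>
    obtain r where r: "strict_mono r" "(Z \<circ> r) \<longlonglongrightarrow> Zstar" using assms(17) by blast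
    define \<sigma>s where "\<sigma>s = min \<sigma>max (norm (F Zstar))"
    have \<sigma>s: "0 < \<sigma>s" using Fstar \<sigma>max by (simp add: \<sigma>s_def)
    define R where "R = (\<lambda>k. J (Z k) (dZ k) + \<sigma> k *\<^sub>R dY k + F (Z k))"
    have limF: "(\<lambda>k. F (Z (r k))) \<longlonglongrightarrow> F Zstar"
      using tendsto_Fmap[OF r(2) Zstar] by (simp add: F_def o_def)
    have lim\<sigma>: "(\<lambda>k. \<sigma> (r k)) \<longlonglongrightarrow> \<sigma>s"
      unfolding \<sigma>_def \<sigma>s_def by (intro tendsto_intros limF)
    have limR: "(\<lambda>k. R (r k)) \<longlonglongrightarrow> 0"
    proof (rule Lim_null_comparison)
      show "\<forall>\<^sub>F k in sequentially. norm (R (r k)) \<le> (\<eta> \<circ> r) k * norm (F (Z (r k)))"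
      proof (intro always_eventually allI)
        fix k
        have "norm (R (r k)) \<le> min (\<eta> (r k)) (norm (F (Z (r k)))) * norm (F (Z (r k)))" unfolding R_def by (rule res)
        also have "\<dots> \<le> \<eta> (r k) * norm (F (Z (r k)))" by (intro mult_right_mono) auto
        finally show "norm (R (r k)) \<le> (\<eta> \<circ> r) k * norm (F (Z (r k)))" by simp
      qed
      have "(\<eta> \<circ> r) \<longlonglongrightarrow> 0" by (rule LIMSEQ_subseq_LIMSEQ[OF \<eta>(2) r(1)])
      from tendsto_mult[OF this tendsto_norm[OF limF]]
      show "(\<lambda>k. (\<eta> \<circ> r) k * norm (F (Z (r k)))) \<longlonglongrightarrow> 0" by simp
    qed
    have inner_eq: "g (Z k) (dZ k) (dZ k) = J (Z k) (dZ k) \<bullet> dY k" for k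
      by (rule g_dZ[OF dZ_tan])
    have J_eq: "J (Z k) (dZ k) = R k - F (Z k) - \<sigma> k *\<^sub>R dY k" for k by (simp add: R_def)
    \<comment> \<open>Pair the perturbed Newton equation with \<open>dY k\<close>: the adjoint turns
      J dZ . dY into the squared Riemannian length of \<open>dZ k\<close>, which is nonnegative, so
      \<open>\<sigma> k\<close> alone controls \<open>dY k\<close>.\<close>
    have dY_bound: "norm (dY k) \<le> (norm (R k) + norm (F (Z k))) / \<sigma> k" for k
    proof -
      have "0 \<le> J (Z k) (dZ k) \<bullet> dY k"
        unfolding inner_eq[symmetric] g_def by (rule metric_nonneg[OF Zman])
      then have "\<sigma> k * (norm (dY k))\<^sup>2 \<le> (R k - F (Z k)) \<bullet> dY k"
        unfolding J_eq by (simp add: inner_diff_left power2_norm_eq_inner)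
      also have "\<dots> \<le> norm (R k - F (Z k)) * norm (dY k)" by (rule norm_cauchy_schwarz)
      also have "\<dots> \<le> (norm (R k) + norm (F (Z k))) * norm (dY k)"
        by (intro mult_right_mono norm_triangle_ineq4) auto
      finally have "(\<sigma> k * norm (dY k)) * norm (dY k) \<le> (norm (R k) + norm (F (Z k))) * norm (dY k)"
        by (simp add: power2_eq_square mult.assoc)
      then have "\<sigma> k * norm (dY k) \<le> norm (R k) + norm (F (Z k))"
        by (cases "dY k = 0") auto
      then show ?thesis using \<sigma>pos[of k] by (simp add: field_simps)
    qed
    obtain MY where MY: "0 < MY" "\<And>k. norm ((norm (R (r k)) + norm (F (Z (r k)))) / \<sigma> (r k)) \<le> MY"
    proof (rule convergent_norm_bound)
      show "(\<lambda>k. (norm (R (r k)) + norm (F (Z (r k)))) / \<sigma> (r k)) \<longlonglongrightarrow> (norm (0 :: 'n matrix) + norm (F Zstar)) / \<sigma>s"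
        using \<sigma>s by (intro tendsto_intros limR limF lim\<sigma>) auto
    qed blast
    have dYb: "norm (dY (r k)) \<le> MY" for k 
      using order_trans[OF order_trans[OF dY_bound abs_ge_self] MY(2)[unfolded real_norm_def]] .
    obtain MZ where MZ: "0 < MZ" "\<And>k. norm ((Z \<circ> r) k) \<le> MZ" using convergent_norm_bound[OF r(2)] by blast
    obtain MJ where MJ: "0 < MJ" "\<And>k. norm (norm (R (r k)) + norm (F (Z (r k)))) \<le> MJ"
    proof (rule convergent_norm_bound)
      show "(\<lambda>k. norm (R (r k)) + norm (F (Z (r k)))) \<longlonglongrightarrow> norm (0 :: 'n matrix) + norm (F Zstar)"
        by (intro tendsto_intros limR limF)
    qed blast
    define \<omega> where "\<omega> = max 1 MZ"
    have norm_dZ: "(norm (dZ (r k)))\<^sup>2 \<le> \<omega> * (J (Z (r k)) (dZ (r k)) \<bullet> dY (r k))" for k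
      unfolding inner_eq[symmetric] g_def
      using MZ(2)[of k] by (intro norm_le_metric Zman dZ_tan) (auto simp: \<omega>_def)
    \<comment> \<open>The Newton equation itself expresses J dZ through R, F and dY, so its bound
      follows from those already obtained.\<close>
    have dZb: "norm (dZ (r k)) \<le> sqrt (\<omega> * ((MJ + MY) * MY))" for k
    proof -
      have "\<sigma> (r k) \<le> 1" using \<sigma>max by (simp add: \<sigma>_def)
      then have "\<sigma> (r k) * norm (dY (r k)) \<le> 1 * MY"
        using dYb[of k] \<sigma>pos[of "r k"] MY by (intro mult_mono) auto
      moreover have "norm (J (Z (r k)) (dZ (r k))) \<le> norm (R (r k)) + norm (F (Z (r k))) + \<sigma> (r k) * norm (dY (r k))"
        unfolding J_eq using \<sigma>pos[of "r k"]
        by (intro order_trans[OF norm_triangle_ineq4] add_mono) (auto intro: norm_triangle_ineq4)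
      ultimately have "norm (J (Z (r k)) (dZ (r k))) \<le> MJ + MY" using MJ(2)[of k] by simp
      then have "norm (J (Z (r k)) (dZ (r k))) * norm (dY (r k)) \<le> (MJ + MY) * MY"
        using dYb[of k] MJ MY by (intro mult_mono) auto
      then have "J (Z (r k)) (dZ (r k)) \<bullet> dY (r k) \<le> (MJ + MY) * MY"
        using norm_cauchy_schwarz order_trans by blast
      then have "\<omega> * (J (Z (r k)) (dZ (r k)) \<bullet> dY (r k)) \<le> \<omega> * ((MJ + MY) * MY)"
        by (intro mult_left_mono) (auto simp: \<omega>_def)
      then show ?thesis using norm_dZ[of k] by (intro real_le_rsqrt) linarith
    qed
    obtain Ys \<zeta> q where q: "strict_mono q" "((\<lambda>k. (dY (r k), dZ (r k))) \<circ> q) \<longlonglongrightarrow> (Ys, \<zeta>)"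
    proof -
      have "\<forall>k. (dY (r k), dZ (r k)) \<in> cball 0 MY \<times> cball 0 (sqrt (\<omega> * ((MJ + MY) * MY)))"
        using dYb dZb by simp
      moreover have "compact (cball (0 :: 'n matrix) MY \<times> cball (0 :: 'n point) (sqrt (\<omega> * ((MJ + MY) * MY))))"
        by (intro compact_Times compact_cball)
      ultimately obtain l q where "strict_mono q" "((\<lambda>k. (dY (r k), dZ (r k))) \<circ> q) \<longlonglongrightarrow> l"
        by (meson compact_def)
      then show ?thesis using that[of q "fst l" "snd l"] by simp
    qed
    define p where "p = r \<circ> q"
    have p: "strict_mono p" unfolding p_def by (rule strict_mono_o[OF r(1) q(1)])
    have limY: "(\<lambda>k. dY (p k)) \<longlonglongrightarrow> Ys" and limdZ: "(\<lambda>k. dZ (p k)) \<longlonglongrightarrow> \<zeta>"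
      using tendsto_fst[OF q(2)] tendsto_snd[OF q(2)] by (simp_all add: p_def o_def)
    have limZ: "(\<lambda>k. Z (p k)) \<longlonglongrightarrow> Zstar"
      using LIMSEQ_subseq_LIMSEQ[OF r(2) q(1)] by (simp add: p_def o_def)
    have limFp: "(\<lambda>k. F (Z (p k))) \<longlonglongrightarrow> F Zstar" and lim\<sigma>p: "(\<lambda>k. \<sigma> (p k)) \<longlonglongrightarrow> \<sigma>s"
      and limRp: "(\<lambda>k. R (p k)) \<longlonglongrightarrow> 0"
      using LIMSEQ_subseq_LIMSEQ[OF limF q(1)] LIMSEQ_subseq_LIMSEQ[OF lim\<sigma> q(1)] LIMSEQ_subseq_LIMSEQ[OF limR q(1)]
      by (simp_all add: p_def o_def)
    have limJ: "(\<lambda>k. J (Z (p k)) (\<xi> k)) \<longlonglongrightarrow> J Zstar \<xi>0" if "\<xi> \<longlonglongrightarrow> \<xi>0" for \<xi> \<xi>0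
      unfolding J_def by (rule tendsto_dFmap[OF limZ Zstar that])
    have J\<zeta>: "J Zstar \<zeta> = - (\<sigma>s *\<^sub>R Ys) - F Zstar"
    proof -
      have "(\<lambda>k. R (p k) - F (Z (p k)) - \<sigma> (p k) *\<^sub>R dY (p k)) \<longlonglongrightarrow> 0 - F Zstar - \<sigma>s *\<^sub>R Ys"
        by (intro tendsto_intros limRp limFp lim\<sigma>p limY)
      then have "(\<lambda>k. J (Z (p k)) (dZ (p k))) \<longlonglongrightarrow> 0 - F Zstar - \<sigma>s *\<^sub>R Ys"
        unfolding J_eq .
      from LIMSEQ_unique[OF limJ[OF limdZ] this] show ?thesis by simp
    qed
    show ?thesis
    proof (cases "\<zeta> = 0")

      \<comment> \<open>Vanishing limit direction\<close>
      case True
      have J0: "J Zstar \<zeta> = 0" unfolding True J_def by (rule linear_0[OF linear_dFmap[OF Zstar]])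
      have "F Zstar = - (\<sigma>s *\<^sub>R Ys) - J Zstar \<zeta>" unfolding J\<zeta> by simp
      then have Ys: "F Zstar = - (\<sigma>s *\<^sub>R Ys)" unfolding J0 by simp
      have "J Zstar \<xi> \<bullet> F Zstar = 0" if \<xi>: "\<xi> \<in> tangent s Zstar" for \<xi>
      proof -
        \<comment> \<open>The adjoint identity for \<open>dZ\<close> at \<open>Z (p k)\<close> holds
          only for vectors tangent there, so a vector tangent at \<open>Zstar\<close> is first
          approximated by such vectors.\<close>
        obtain \<xi>' where \<xi>': "\<And>k. \<xi>' k \<in> tangent s (Z (p k))" "\<xi>' \<longlonglongrightarrow> \<xi>"
          by (rule tangent_approx[where Z = "\<lambda>k. Z (p k)", OF Zman limZ Zstar \<xi>], rule that)
        have "(\<lambda>k. g (Z (p k)) (\<xi>' k) (dZ (p k))) \<longlonglongrightarrow> g Zstar \<xi> \<zeta>"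
          unfolding g_def by (rule tendsto_metric[OF limZ Zstar \<xi>'(2) limdZ])
        then have A: "(\<lambda>k. J (Z (p k)) (\<xi>' k) \<bullet> dY (p k)) \<longlonglongrightarrow> g Zstar \<xi> \<zeta>"
          by (simp only: g_dZ[OF \<xi>'(1)])
        have B: "(\<lambda>k. J (Z (p k)) (\<xi>' k) \<bullet> dY (p k)) \<longlonglongrightarrow> J Zstar \<xi> \<bullet> Ys"
          by (intro tendsto_intros limJ \<xi>'(2) limY)
        have "J Zstar \<xi> \<bullet> Ys = g Zstar \<xi> \<zeta>" by (rule LIMSEQ_unique[OF B A])
        also have "g Zstar \<xi> \<zeta> = 0"
          by (simp add: True g_def metric_eq_inner_scale[OF Zstar] linear_0[OF linear_metric_scale])
        finally show ?thesis by (simp add: Ys)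
      qed
      then show ?thesis unfolding riem_grad_eq[OF Zstar]
        by (intro DF_adjoint_eq_0[OF Zstar]) (simp add: F_def J_def)
    next

      \<comment> \<open>Nonvanishing limit direction\<close>
      case False
      define ds where "ds = J Zstar \<zeta> \<bullet> F Zstar"
      have limd: "(\<lambda>k. d (p k) (dZ (p k))) \<longlonglongrightarrow> ds" unfolding d ds_def by (intro tendsto_intros limJ limdZ limFp)
      have "(norm \<zeta>)\<^sup>2 \<le> \<omega> * (J Zstar \<zeta> \<bullet> Ys)"
      proof (rule LIMSEQ_le)
        show "(\<lambda>k. (norm (dZ (p k)))\<^sup>2) \<longlonglongrightarrow> (norm \<zeta>)\<^sup>2" by (intro tendsto_intros limdZ)
        show "(\<lambda>k. \<omega> * (J (Z (p k)) (dZ (p k)) \<bullet> dY (p k))) \<longlonglongrightarrow> \<omega> * (J Zstar \<zeta> \<bullet> Ys)"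
          by (intro tendsto_intros limJ limdZ limY)
        show "\<exists>N. \<forall>k\<ge>N. (norm (dZ (p k)))\<^sup>2 \<le> \<omega> * (J (Z (p k)) (dZ (p k)) \<bullet> dY (p k))"
          using norm_dZ by (simp add: p_def)
      qed
      moreover have "0 < (norm \<zeta>)\<^sup>2" using False by simp
      ultimately have "0 < \<omega> * (J Zstar \<zeta> \<bullet> Ys)" by linarith
      then have JY: "0 < J Zstar \<zeta> \<bullet> Ys" by (simp add: \<omega>_def zero_less_mult_iff)
      \<comment> \<open>Pairing the limiting Newton equation with J \<zeta> makes the slope
        \<open>ds\<close> a sum of two nonpositive terms; the one with \<open>Ys\<close> is strictly
        negative by \<open>JY\<close>.\<close>
      have "F Zstar = - J Zstar \<zeta> - \<sigma>s *\<^sub>R Ys" by (simp add: J\<zeta>)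
      from arg_cong[OF this, of "inner (J Zstar \<zeta>)"]
      have "ds = - (J Zstar \<zeta> \<bullet> J Zstar \<zeta>) - \<sigma>s * (J Zstar \<zeta> \<bullet> Ys)"
        unfolding ds_def by (simp only: inner_diff_right inner_minus_right inner_scaleR_right)
      moreover have "0 < \<sigma>s * (J Zstar \<zeta> \<bullet> Ys)" using \<sigma>s JY by simp
      ultimately have ds: "ds < 0" using inner_ge_zero[of "J Zstar \<zeta>"] by linarith
      have limep: "(\<lambda>k. e (p k)) \<longlonglongrightarrow> 0" using LIMSEQ_subseq_LIMSEQ[OF e0 p] by (simp add: o_def)
      \<comment> \<open>A full step has e = (1 - \<tau>^2) |F|^2, which stays near a positive limit,
        while \<open>e\<close> tends to 0 along \<open>p\<close>.\<close>
      have nf: "\<forall>\<^sub>F k in sequentially. \<not> full (p k) (dZ (p k))"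
      proof -
        have "(\<lambda>k. (1 - \<tau>\<^sup>2) * (norm (F (Z (p k))))\<^sup>2 - e (p k)) \<longlonglongrightarrow> (1 - \<tau>\<^sup>2) * (norm (F Zstar))\<^sup>2 - 0"
          by (intro tendsto_intros limFp limep)
        moreover have "0 < (1 - \<tau>\<^sup>2) * (norm (F Zstar))\<^sup>2 - 0" using \<tau>2 Fstar by simp
        ultimately have "\<forall>\<^sub>F k in sequentially. 0 < (1 - \<tau>\<^sup>2) * (norm (F (Z (p k))))\<^sup>2 - e (p k)"
          by (rule order_tendstoD(1))
        then show ?thesis by eventually_elim (auto simp: e_def)
      qed
      have "(\<lambda>k. e (p k) / (\<delta> * \<bar>d (p k) (dZ (p k))\<bar>)) \<longlonglongrightarrow> 0 / (\<delta> * \<bar>ds\<bar>)"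
        using \<delta> ds by (intro tendsto_intros limep limd) auto
      moreover have "\<forall>\<^sub>F k in sequentially. e (p k) / (\<delta> * \<bar>d (p k) (dZ (p k))\<bar>) = (\<alpha> (p k))\<^sup>2"
        using nf order_tendstoD(2)[OF limd ds]
        by eventually_elim (use \<delta> in \<open>auto simp: e_def\<close>)
      ultimately have "(\<lambda>k. (\<alpha> (p k))\<^sup>2) \<longlonglongrightarrow> 0 / (\<delta> * \<bar>ds\<bar>)"
        by (rule Lim_transform_eventually)
      then have "(\<lambda>k. (\<alpha> (p k))\<^sup>2) \<longlonglongrightarrow> 0" by simp
      from tendsto_real_sqrt[OF this] have lim\<alpha>: "(\<lambda>k. \<alpha> (p k)) \<longlonglongrightarrow> 0"
        using \<alpha>pos by (simp add: less_imp_le)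
      \<comment> \<open>The last trial step before acceptance. It was rejected as soon as \<alpha> <
        1, and it still tends to 0.\<close>
      define t where "t = (\<lambda>k. \<alpha> (p k) / \<rho>)"
      have tpos: "0 < t k" for k using \<alpha>pos \<rho> by (simp add: t_def)
      have limt: "t \<longlonglongrightarrow> 0" using tendsto_divide[OF lim\<alpha> tendsto_const[of \<rho>]] \<rho> by (simp add: t_def)
      define Z' where "Z' = (\<lambda>k. retract s (Z (p k)) (t k *\<^sub>R dZ (p k)))"
      have fail: "\<forall>\<^sub>F k in sequentially.
          - \<delta> * t k * \<bar>d (p k) (dZ (p k))\<bar> \<le> ((norm (F (Z' k)))\<^sup>2 - (norm (F (Z (p k))))\<^sup>2) / t k"
        using nf order_tendstoD(2)[OF lim\<alpha> zero_less_one]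
      proof eventually_elim
        case (elim k)
        then obtain l where l: "\<alpha> (p k) = \<rho> ^ l" "\<And>l'. LS (p k) (dZ (p k)) (\<rho> ^ l') \<Longrightarrow> \<rho> ^ l' \<le> \<rho> ^ l"
          using not_full by blast
        \<comment> \<open>The exponent 0 would mean \<alpha> = 1. So \<alpha> / \<rho> is a trial
          value \<rho>^(l-1) larger than \<alpha>, and maximality of \<alpha> says that the line
          search refused it.\<close>
        have "l \<noteq> 0" using elim(2) l(1) by (intro notI) simp
        then obtain l' where l': "l = Suc l'" using not0_implies_Suc by blast
        then have tk: "t k = \<rho> ^ l'" using \<rho> by (simp add: t_def l(1))
        have "\<not> \<rho> ^ l' \<le> \<rho> ^ l" using \<rho> by (simp add: l')
        then have "\<not> LS (p k) (dZ (p k)) (t k)" using l(2) tk by auto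
        then have "- \<delta> * (t k)\<^sup>2 * \<bar>d (p k) (dZ (p k))\<bar> + \<gamma> (p k) * (norm (F (Z (p k))))\<^sup>2 \<le> (norm (F (Z' k)))\<^sup>2 - (norm (F (Z (p k))))\<^sup>2"
          by (simp add: LS_def Z'_def)
        \<comment> \<open>In a rejected inequality the \<gamma> term stands on the smaller side, so
          dropping it preserves the bound. Dividing by t then leaves a left side of order t.\<close>
        moreover have "0 \<le> \<gamma> (p k) * (norm (F (Z (p k))))\<^sup>2" using \<gamma>(1)[of "p k"] by simp
        ultimately have "- \<delta> * (t k)\<^sup>2 * \<bar>d (p k) (dZ (p k))\<bar> \<le> (norm (F (Z' k)))\<^sup>2 - (norm (F (Z (p k))))\<^sup>2" by linarith
        then have "- \<delta> * (t k)\<^sup>2 * \<bar>d (p k) (dZ (p k))\<bar> / t k \<le> ((norm (F (Z' k)))\<^sup>2 - (norm (F (Z (p k))))\<^sup>2) / t k"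
          using tpos[of k] by (intro divide_right_mono) auto
        then show ?case using tpos[of k] by (simp add: power2_eq_square)
      qed
      have quotF: "(\<lambda>k. (F (Z' k) - F (Z (p k))) /\<^sub>R t k) \<longlonglongrightarrow> J Zstar \<zeta>"
        unfolding F_def J_def
      proof (rule Fmap_quotient[OF limZ _ Zstar tpos limt])
        show "(\<lambda>k. (Z' k - Z (p k)) /\<^sub>R t k) \<longlonglongrightarrow> \<zeta>"
          unfolding Z'_def by (rule retract_quotient[where Z = "\<lambda>k. Z (p k)", OF Zman limZ Zstar dZ_tan limdZ tpos limt])
      qed
      have limF': "(\<lambda>k. F (Z' k)) \<longlonglongrightarrow> F Zstar"
        by (rule tendsto_of_quotient[OF limFp quotF tpos limt])
      \<comment> \<open>The difference of squared norms factors as (F' - F) . (F' + F), whose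
        quotient by t tends to twice the slope \<open>ds\<close>. The rejected tests force this
        limit to be nonnegative.\<close>
      have "(\<lambda>k. ((F (Z' k) - F (Z (p k))) /\<^sub>R t k) \<bullet> (F (Z' k) + F (Z (p k)))) \<longlonglongrightarrow> J Zstar \<zeta> \<bullet> (F Zstar + F Zstar)"
        by (intro tendsto_intros quotF limF' limFp)
      moreover have "((F (Z' k) - F (Z (p k))) /\<^sub>R t k) \<bullet> (F (Z' k) + F (Z (p k)))
          = ((norm (F (Z' k)))\<^sup>2 - (norm (F (Z (p k))))\<^sup>2) / t k" for k
        by (simp only: power2_norm_eq_inner inner_add_right inner_diff_left inner_scaleR_left
            inner_commute[of "F (Z (p k))" "F (Z' k)"] divide_inverse_commute) (simp add: algebra_simps)
      ultimately have "(\<lambda>k. ((norm (F (Z' k)))\<^sup>2 - (norm (F (Z (p k))))\<^sup>2) / t k) \<longlonglongrightarrow> 2 * ds"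
        by (simp only: ds_def inner_add_right mult_2)
      moreover have "(\<lambda>k. - \<delta> * t k * \<bar>d (p k) (dZ (p k))\<bar>) \<longlonglongrightarrow> - \<delta> * 0 * \<bar>ds\<bar>"
        by (intro tendsto_intros limt limd)
      ultimately have "- \<delta> * 0 * \<bar>ds\<bar> \<le> 2 * ds"
        using fail by (intro tendsto_le[OF sequentially_bot])
      with ds show ?thesis by simp
    qed
  qed
qed

end
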